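(* For every constant $a>0$ there exist constants $c,C>0$ (depending only on $a$) such that for all positive integers $s\leq t$ with $t \geq a\, s\log s$, $$c\, s^2 t 2^s \leq \hat r(K_{s,t}) \leq C\, s^2 t 2^s .$$ That is, if $t=\Omega(s\log s)$, then $\hat r(K_{s,t})=\Theta(s^2t2^s)$.
   Context: All graphs are finite and simple; $\log$ is the base-$2$ logarithm. $K_{s,t}$ denotes the complete bipartite graph with parts of sizes $s$ and $t$. A copy of $H$ in $G$ means a (not necessarily induced) subgraph of $G$ isomorphic to $H$. A graph $G$ is Ramsey for a graph $H$ if every two-coloring of the edges of $G$ contains a monochromatic copy of $H$. The size Ramsey number $\hat r(H)$ is the minimum number of edges in a graph $G$ which is Ramsey for $H$. *)

theory Defs
  imports Complex_Main
begin

record 'a ugraph =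
  verts :: "'a set"
  edges :: "'a set set"

definition finite_simple_graph :: "'a ugraph \<Rightarrow> bool" where
  "finite_simple_graph G \<longleftrightarrow>
     finite (verts G) \<and> (\<forall>e\<in>edges G. e \<subseteq> verts G \<and> card e = 2)"

definition is_subgraph :: "'a ugraph \<Rightarrow> 'a ugraph \<Rightarrow> bool" where
  "is_subgraph K G \<longleftrightarrow>
     finite_simple_graph K \<and> verts K \<subseteq> verts G \<and> edges K \<subseteq> edges G"

definition isomorphic :: "'a ugraph \<Rightarrow> 'b ugraph \<Rightarrow> bool" where
  "isomorphic G H \<longleftrightarrow>
     (\<exists>f. bij_betw f (verts G) (verts H) \<and> (\<lambda>e. f ` e) ` edges G = edges H)"

definition is_copy_in :: "'a ugraph \<Rightarrow> 'b ugraph \<Rightarrow> 'a ugraph \<Rightarrow> bool" where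
  "is_copy_in K H G \<longleftrightarrow> is_subgraph K G \<and> isomorphic K H"

definition ramsey_for :: "'a ugraph \<Rightarrow> 'b ugraph \<Rightarrow> bool" where
  "ramsey_for G H \<longleftrightarrow>
     (\<forall>col :: 'a set \<Rightarrow> bool. \<exists>K b. is_copy_in K H G \<and> (\<forall>e\<in>edges K. col e = b))"

(* Every finite graph is isomorphic to one with vertices in nat, so letting G range
   over nat ugraph loses nothing. For finite simple H the minimum exists by Ramsey's
   theorem (a large enough complete graph is Ramsey for H). *)
definition size_ramsey :: "'b ugraph \<Rightarrow> nat" where
  "size_ramsey H =
     (LEAST m. \<exists>G :: nat ugraph. finite_simple_graph G \<and> ramsey_for G H \<and> card (edges G) = m)"

definition complete_bipartite :: "nat \<Rightarrow> nat \<Rightarrow> (nat + nat) ugraph" where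
  "complete_bipartite s t =
     \<lparr>verts = {..<s} <+> {..<t}, edges = {{Inl i, Inr j} | i j. i < s \<and> j < t}\<rparr>"

end

theory Submission
  imports Defs "HOL-Library.FuncSet"
begin

text \<open>
  Upper bound: in any two-coloring of the complete bipartite graph with sides of sizes \<open>2s\<^sup>2\<close>
  and \<open>6t2\<^sup>s\<close>, half of the vertices of the large side share the same majority color.
  Averaging their majority neighborhoods over the \<open>s\<close>-subsets of the small side gives a
  monochromatic copy, since \<open>(2s\<^sup>2 choose s) \<le> 3 * 2\<^sup>s (s\<^sup>2 choose s)\<close>.

  Lower bound: a graph with \<open>m \<le> c s\<^sup>2 t 2\<^sup>s\<close> edges gets a random coloring in which each
  edge is owned by one of its endpoints and every vertex colors a uniformly random half of
  its own edges red. Any \<open>k\<close> edges owned by \<open>v\<close> are all red with probability at most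
  \<open>2^(-k) min(1, 8d/k\<^sup>2)\<close>, where \<open>d\<close> is the number of edges owned by \<open>v\<close>. As the numbers
  \<open>d\<close> add up to at most \<open>m\<close>, this gains the factor \<open>s\<^sup>2\<close> for the copies whose side \<open>S\<close> of
  size \<open>s\<close> consists of vertices of degree at least \<open>\<delta> t 2\<^sup>s\<close>, of which there are at most \<open>s\<^sup>2\<close>.
  The expected number of the remaining copies is small already because each of them is
  monochromatic with probability at most \<open>2 * 2^(-st)\<close>. The hypothesis \<open>t \<ge> a s log s\<close> makes
  \<open>s\<^sup>s\<close>, the cost of choosing \<open>S\<close>, at most exponential in \<open>t\<close>.
\<close>

subsection \<open>Copies of complete bipartite graphs\<close>

definition bip :: "'a set \<Rightarrow> 'a set \<Rightarrow> 'a set set" where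
  "bip S T = {{u, v} | u v. u \<in> S \<and> v \<in> T}"

text \<open>The sides are the images of the two parts under the inverse of the isomorphism. From
  here on a copy is a pair of disjoint vertex sets, with no isomorphism attached.\<close>

lemma copy_sides:
  assumes "is_copy_in K (complete_bipartite s t) G"
  obtains S T where "S \<subseteq> verts G" "T \<subseteq> verts G" "finite S" "finite T" "card S = s" "card T = t"
    "S \<inter> T = {}" "edges K = bip S T" "edges K \<subseteq> edges G"
proof -
  let ?H = "complete_bipartite s t"
  from assms obtain f where sub: "is_subgraph K G" and f: "bij_betw f (verts K) (verts ?H)"
    and fe: "(\<lambda>e. f ` e) ` edges K = edges ?H"
    unfolding is_copy_in_def isomorphic_def by auto
  define g where "g = inv_into (verts K) f"
  have g: "bij_betw g (verts ?H) (verts K)"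
    unfolding g_def by (rule bij_betw_inv_into[OF f])
  have gf: "g (f x) = x" if "x \<in> verts K" for x
    using f that unfolding g_def by (simp add: bij_betw_inv_into_left)
  have "g ` f ` e = e" if "e \<in> edges K" for e
  proof -
    have "e \<subseteq> verts K" using sub that unfolding is_subgraph_def finite_simple_graph_def by blast
    then show ?thesis using gf by (force simp: image_image)
  qed
  then have "edges K = (\<lambda>e. g ` e) ` (\<lambda>e. f ` e) ` edges K"
    by (simp add: image_image)
  then have ge: "edges K = (\<lambda>e. g ` e) ` edges ?H" by (simp add: fe)
  define S where "S = g ` Inl ` {..<s}"
  define T where "T = g ` Inr ` {..<t}"
  have vH: "verts ?H = Inl ` {..<s} \<union> Inr ` {..<t}"
    by (auto simp: complete_bipartite_def)
  have inj: "inj_on g (Inl ` {..<s} \<union> Inr ` {..<t})" using g vH by (simp add: bij_betw_def)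
  have sV: "S \<subseteq> verts K" "T \<subseteq> verts K" using g vH unfolding S_def T_def bij_betw_def by auto
  have "card S = s" unfolding S_def
    by (subst card_image, rule inj_on_subset[OF inj]) (auto simp: card_image)
  moreover have "card T = t" unfolding T_def
    by (subst card_image, rule inj_on_subset[OF inj]) (auto simp: card_image)
  moreover have "S \<inter> T = {}" unfolding S_def T_def
    by (subst inj_on_image_Int[OF inj, symmetric]) auto
  moreover have "edges K = bip S T"
    unfolding ge bip_def S_def T_def complete_bipartite_def by (auto simp: image_iff) blast+
  moreover have "S \<subseteq> verts G" "T \<subseteq> verts G" "edges K \<subseteq> edges G"
    using sub sV unfolding is_subgraph_def by auto
  moreover have "finite S" "finite T" by (auto simp: S_def T_def)
  ultimately show ?thesis using that by blast
qed

text \<open>Enumerations of the two sides are glued to an isomorphism; disjointness makes the gluing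
  well behaved on \<open>T\<close>.\<close>

lemma copy_of_sides:
  assumes "S \<subseteq> verts G" "T \<subseteq> verts G" "finite S" "finite T" "card S = s" "card T = t"
    "S \<inter> T = {}" "bip S T \<subseteq> edges G"
  shows "is_copy_in \<lparr>verts = S \<union> T, edges = bip S T\<rparr> (complete_bipartite s t) G"
proof -
  obtain h where h: "bij_betw h S {..<s}"
    using assms finite_same_card_bij[of S "{..<s}"] by auto
  obtain k where k: "bij_betw k T {..<t}"
    using assms finite_same_card_bij[of T "{..<t}"] by auto
  define f where "f v = (if v \<in> S then Inl (h v) else Inr (k v))" for v
  have fS: "f v = Inl (h v)" if "v \<in> S" for v using that by (simp add: f_def)
  have fT: "f v = Inr (k v)" if "v \<in> T" for v using that assms(7) by (auto simp: f_def)
  have "bij_betw f S (Inl ` {..<s})" "bij_betw f T (Inr ` {..<t})"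
    using h k fS fT unfolding bij_betw_def inj_on_def by (auto simp: image_iff)
  then have "bij_betw f (S \<union> T) (Inl ` {..<s} \<union> Inr ` {..<t})"
    by (rule bij_betw_combine) auto
  moreover have "Inl ` {..<s} \<union> Inr ` {..<t} = verts (complete_bipartite s t)"
    by (auto simp: complete_bipartite_def)
  ultimately have bij: "bij_betw f (S \<union> T) (verts (complete_bipartite s t))" by simp
  have "(\<lambda>e. f ` e) ` bip S T = edges (complete_bipartite s t)"
  proof (intro equalityI subsetI)
    fix e assume "e \<in> (\<lambda>e. f ` e) ` bip S T"
    then obtain u v where "u \<in> S" "v \<in> T" "e = {f u, f v}" unfolding bip_def by auto
    moreover from this have "h u < s" "k v < t" using h k unfolding bij_betw_def by auto
    ultimately show "e \<in> edges (complete_bipartite s t)"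
      by (auto simp: complete_bipartite_def fS fT)
  next
    fix e assume "e \<in> edges (complete_bipartite s t)"
    then obtain i j where ij: "i < s" "j < t" "e = {Inl i, Inr j}"
      by (auto simp: complete_bipartite_def)
    obtain u v where uv: "u \<in> S" "h u = i" "v \<in> T" "k v = j"
      using h k ij unfolding bij_betw_def by (metis imageE lessThan_iff)
    then have "e = f ` {u, v}" using ij fS fT by simp
    then show "e \<in> (\<lambda>e. f ` e) ` bip S T" unfolding bip_def using uv by blast
  qed
  moreover have "finite_simple_graph \<lparr>verts = S \<union> T, edges = bip S T\<rparr>"
    using assms unfolding finite_simple_graph_def bip_def by (auto simp: card_insert_if)
  ultimately show ?thesis
    using bij assms unfolding is_copy_in_def is_subgraph_def isomorphic_def by auto
qed

lemma card_bip:
  assumes "S \<inter> T = {}"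
  shows "card (bip S T) = card S * card T"
proof -
  have "bip S T = (\<lambda>(u, v). {u, v}) ` (S \<times> T)" unfolding bip_def by auto
  moreover have "inj_on (\<lambda>(u, v). {u, v}) (S \<times> T)"
    using assms by (auto simp: inj_on_def doubleton_eq_iff)
  ultimately show ?thesis by (simp add: card_image card_cartesian_product)
qed

lemma finite_bip: "finite S \<Longrightarrow> finite T \<Longrightarrow> finite (bip S T)"
  unfolding bip_def by (rule finite_subset[of _ "(\<lambda>(u, v). {u, v}) ` (S \<times> T)"]) auto

subsection \<open>Counting subsets\<close>

text \<open>Weak form of Stirling's formula: passing from \<open>n\<close> to \<open>n + 1\<close>
  costs the factor \<open>(1 + 1 / n) ^ n\<close>, which is at most e and hence at most 3.\<close>

lemma power_le_3_power_fact: "real n ^ n \<le> 3 ^ n * fact n"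
proof (induction n)
  case (Suc n)
  show ?case
  proof (cases "n = 0")
    case False
    have "(1 + 1 / real n) ^ n \<le> exp 1"
      using exp_ge_one_plus_x_over_n_power_n[of n 1] False by simp
    also have "\<dots> \<le> 3" by (rule exp_le)
    finally have e: "(1 + 1 / real n) ^ n \<le> 3" .
    have "real (Suc n) ^ n = (1 + 1 / real n) ^ n * real n ^ n"
      using False by (simp add: power_mult_distrib[symmetric] field_simps)
    also have "\<dots> \<le> 3 * (3 ^ n * fact n)" by (rule mult_mono[OF e Suc.IH]) auto
    finally have "real (Suc n) ^ n * real (Suc n) \<le> 3 * (3 ^ n * fact n) * real (Suc n)"
      by (rule mult_right_mono) simp
    then show ?thesis by (simp add: algebra_simps)
  qed simp
qed simp

text \<open>These are the first two terms of the binomial expansion. They drive the induction in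
  \<open>sum_prod_subsets_le\<close>.\<close>

lemma bernoulli_add:
  fixes x y :: real
  assumes "x \<ge> 0" "y \<ge> 0"
  shows "x ^ Suc n + real (Suc n) * y * x ^ n \<le> (x + y) ^ Suc n"
proof (induction n)
  case (Suc n)
  have "x ^ Suc (Suc n) + real (Suc (Suc n)) * y * x ^ Suc n
    \<le> (x + y) * (x ^ Suc n + real (Suc n) * y * x ^ n)"
    using assms by (simp add: algebra_simps)
  also have "\<dots> \<le> (x + y) * (x + y) ^ Suc n"
    using Suc.IH assms by (intro mult_left_mono) auto
  finally show ?case by simp
qed simp

text \<open>Expanding the power on the right yields the product over each \<open>t\<close>-subset
  \<open>fact t\<close> times, besides nonnegative terms. The induction on \<open>A\<close> splits
  the subsets by whether they contain the new element.\<close>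

lemma sum_prod_subsets_le:
  fixes w :: "'a \<Rightarrow> real"
  assumes "finite A" "\<And>v. v \<in> A \<Longrightarrow> 0 \<le> w v"
  shows "(\<Sum>T | T \<subseteq> A \<and> card T = t. \<Prod>v\<in>T. w v) * fact t \<le> (\<Sum>v\<in>A. w v) ^ t"
  using assms
proof (induction A arbitrary: t rule: finite_induct)
  case empty
  have *: "{T :: 'a set. T \<subseteq> {} \<and> card T = t} = (if t = 0 then {{}} else {})" by auto
  show ?case unfolding * by simp
next
  case (insert x A)
  show ?case
  proof (cases t)
    case 0
    have "{T. T \<subseteq> insert x A \<and> card T = 0} = {{}}"
      using insert.hyps by (auto dest: finite_subset)
    with 0 show ?thesis by simp
  next
    case (Suc n)
    let ?P = "\<lambda>k. {T. T \<subseteq> A \<and> card T = k}"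
    have split: "{T. T \<subseteq> insert x A \<and> card T = Suc n} = ?P (Suc n) \<union> insert x ` ?P n" (is "?L = ?R")
    proof (intro equalityI subsetI)
      fix T assume T: "T \<in> ?L"
      then have fT: "finite T" using insert.hyps by (auto dest: finite_subset)
      show "T \<in> ?R"
      proof (cases "x \<in> T")
        case True
        then have "T = insert x (T - {x})" "T - {x} \<in> ?P n" using T fT by auto
        then show ?thesis by blast
      qed (use T in auto)
    next
      fix T assume T: "T \<in> ?R"
      have "card (insert x U) = Suc (card U)" if "U \<subseteq> A" for U
        using that insert.hyps by (metis card_insert_disjoint finite_subset subsetD)
      then show "T \<in> ?L" using T by auto
    qed
    have fin: "finite (?P k)" for k using insert.hyps by simp
    have inj: "inj_on (insert x) (?P n)" using insert.hyps by (auto simp: inj_on_def)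
    have ins: "prod w (insert x T) = w x * prod w T" if "T \<in> ?P n" for T
      using that insert.hyps by (subst prod.insert) (auto dest: finite_subset)
    define W where "W = sum w A"
    have W0: "0 \<le> W" unfolding W_def using insert.prems by (intro sum_nonneg) auto
    have "sum (prod w) {T. T \<subseteq> insert x A \<and> card T = Suc n}
        = sum (prod w) (?P (Suc n)) + sum (prod w) (insert x ` ?P n)"
      unfolding split using fin insert.hyps by (intro sum.union_disjoint) auto
    also have "sum (prod w) (insert x ` ?P n) = w x * sum (prod w) (?P n)"
      unfolding sum.reindex[OF inj] using ins by (simp add: sum_distrib_left)
    finally have "sum (prod w) {T. T \<subseteq> insert x A \<and> card T = Suc n} * fact (Suc n)
      = sum (prod w) (?P (Suc n)) * fact (Suc n) + real (Suc n) * w x * (sum (prod w) (?P n) * fact n)"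
      by (simp add: algebra_simps)
    also have "\<dots> \<le> W ^ Suc n + real (Suc n) * w x * W ^ n"
    proof -
      have *: "sum (prod w) (?P k) * fact k \<le> W ^ k" for k
        unfolding W_def using insert.IH insert.prems by auto
      show ?thesis using insert.prems by (intro add_mono mult_left_mono * mult_nonneg_nonneg) auto
    qed
    also have "\<dots> \<le> (W + w x) ^ Suc n"
      using W0 insert.prems by (intro bernoulli_add) auto
    finally show ?thesis using Suc insert.hyps by (simp add: W_def add.commute)
  qed
qed

text \<open>The familiar bound (e |A| / t)^t for a binomial coefficient, with 3 in place of e. The
  factor \<open>t ^ t\<close> stays on the left in all later counts and is cancelled only at the
  end.\<close>

lemma card_subsets_le_power_div:
  assumes "finite A"
  shows "real (card {T. T \<subseteq> A \<and> card T = t}) * real t ^ t \<le> (3 * real (card A)) ^ t"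
proof -
  have "real (card {T. T \<subseteq> A \<and> card T = t}) * real t ^ t
      \<le> real (card {T. T \<subseteq> A \<and> card T = t}) * (3 ^ t * fact t)"
    by (intro mult_left_mono power_le_3_power_fact) auto
  also have "\<dots> = 3 ^ t * (real (card {T. T \<subseteq> A \<and> card T = t}) * fact t)" by simp
  also have "\<dots> \<le> 3 ^ t * real (card A) ^ t"
    using sum_prod_subsets_le[OF assms, of "\<lambda>_. 1" t] by (intro mult_left_mono) auto
  finally show ?thesis by (simp add: power_mult_distrib)
qed

lemma card_subsets_le_power:
  assumes "finite A"
  shows "card {T. T \<subseteq> A \<and> card T = t} \<le> card A ^ t"
  using binomial_le_pow2 n_subsets[OF assms, of t] 
  by (metis binomial_le_pow binomial_eq_0_iff leI le0)

subsection \<open>Random halves\<close>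

text \<open>A finite set of odd size has no half; edge sets are therefore padded to even size before
  they are halved.\<close>

definition half_subsets :: "'a set \<Rightarrow> 'a set set" where
  "half_subsets B = {R. R \<subseteq> B \<and> 2 * card R = card B}"

text \<open>After division by the central binomial coefficient this bounds the probability that a
  random half of \<open>2 * n\<close> points avoids \<open>k\<close> given ones. Given that
  \<open>k\<close> points are avoided, the next one is avoided with probability (n - k) / (2n - k),
  at most half of exp (- k / (2n)); these factors are multiplied up.\<close>

lemma central_binomial_decay:
  assumes "n > 0"
  shows "real ((2 * n - k) choose n) * 2 ^ k
    \<le> real ((2 * n) choose n) * exp (- (real k * (real k - 1) / (4 * real n)))"
proof (induction k)
  case (Suc k)
  show ?case
  proof (cases "k < n")
    case False
    then have z: "(2 * n - Suc k) choose n = 0" using assms by (simp add: binomial_eq_0)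
    show ?thesis unfolding z by simp
  next
    case True
    define N where "N = 2 * n - k"
    have N: "real N = 2 * real n - real k" using True by (simp add: N_def of_nat_diff)
    have "(N - n) * (N choose n) = N * ((N - 1) choose n)" by (rule binomial_absorb_comp)
    then have "real (N - n) * real (N choose n) = real N * real ((N - 1) choose n)"
      by (metis of_nat_mult)
    moreover have "real (N - n) = real n - real k" using True by (simp add: N_def of_nat_diff)
    ultimately have c: "real ((N - 1) choose n) = (real n - real k) / real N * real (N choose n)"
      using N True by (simp add: nonzero_eq_divide_eq mult.commute)
    have "2 * (real n - real k) / real N \<le> 1 - real k / (2 * real n)"
    proof -
      \<comment> \<open>The two sides differ by exactly \<open>k ^ 2\<close>.\<close>
      have "4 * real n * (real n - real k) \<le> real N * real N"
        unfolding N by (simp add: algebra_simps)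
      moreover have "1 - real k / (2 * real n) = real N / (2 * real n)"
        using assms by (simp add: N field_simps)
      moreover have "real N > 0" using True N by simp
      ultimately show ?thesis using assms by (simp add: field_simps)
    qed
    also have "\<dots> \<le> exp (- (real k / (2 * real n)))"
      using exp_ge_add_one_self[of "- (real k / (2 * real n))"] by simp
    finally have r: "2 * (real n - real k) / real N \<le> exp (- (real k / (2 * real n)))" .
    have "real ((2 * n - Suc k) choose n) * 2 ^ Suc k
      = (2 * (real n - real k) / real N) * (real (N choose n) * 2 ^ k)"
      using c by (simp add: N_def)
    also have "\<dots> \<le> exp (- (real k / (2 * real n))) *
       (real ((2 * n) choose n) * exp (- (real k * (real k - 1) / (4 * real n))))"
      by (rule mult_mono[OF r Suc.IH[folded N_def]]) auto
    also have "\<dots> = real ((2 * n) choose n) * exp (- (real k / (2 * real n)) - (real k * (real k - 1) / (4 * real n)))"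
      by (simp add: exp_diff exp_minus field_simps)
    also have "- (real k / (2 * real n)) - (real k * (real k - 1) / (4 * real n))
       = - (real (Suc k) * (real (Suc k) - 1) / (4 * real n))"
      using assms by (simp add: field_simps)
    finally show ?thesis .
  qed
qed simp

text \<open>Both bounds come from \<open>central_binomial_decay\<close>. The second weakens exp (-
  x) to 1 / x: the resulting factor is linear in \<open>card B\<close>, so it can later be summed
  over all vertices.\<close>

lemma half_subsets_prescribed:
  fixes b :: bool
  assumes "finite B" "even (card B)" "F \<subseteq> B"
  defines "M \<equiv> {R \<in> half_subsets B. \<forall>e\<in>F. (e \<in> R) = b}"
  shows "real (card M) \<le> real (card (half_subsets B)) * (1 / 2) ^ card F"
    and "card F \<ge> 2 \<Longrightarrow> real (card M)
      \<le> real (card (half_subsets B)) * (1 / 2) ^ card F * (4 * real (card B) / real (card F) ^ 2)"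
proof -
  obtain n where n: "card B = 2 * n" using assms(2) by auto
  let ?M = "\<lambda>b. {R \<in> half_subsets B. \<forall>e\<in>F. (e \<in> R) = b}"
  have half: "card (half_subsets B) = (2 * n) choose n"
    using n_subsets[OF assms(1), of n] n by (simp add: half_subsets_def)
  have fF: "finite F" using assms by (auto dest: finite_subset)
  have "?M False = {R. R \<subseteq> B - F \<and> card R = n}"
    using n by (auto simp: half_subsets_def)
  then have cF: "card (?M False) = (2 * n - card F) choose n"
    using n_subsets[of "B - F" n] assms n fF by (simp add: card_Diff_subset)
  \<comment> \<open>Complementation preserves halves and exchanges containing \<open>F\<close> with
    avoiding \<open>F\<close>, so both values of \<open>b\<close> give the same count.\<close>
  have "bij_betw (\<lambda>R. B - R) (?M True) (?M False)"
    using assms(1,3) by (intro bij_betw_byWitness[where f' = "\<lambda>R. B - R"])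
      (auto simp: half_subsets_def card_Diff_subset finite_subset)
  then have cM: "card M = (2 * n - card F) choose n"
    using cF unfolding M_def by (cases b) (auto dest: bij_betw_same_card)
  show 1: "real (card M) \<le> real (card (half_subsets B)) * (1 / 2) ^ card F"
  proof (cases "n = 0")
    case True
    then have "F = {}" using n assms by auto
    then show ?thesis using cM half by simp
  next
    case False
    let ?k = "card F"
    have "real ?k * (real ?k - 1) / (4 * real n) \<ge> 0" by (cases ?k) auto
    then have "exp (- (real ?k * (real ?k - 1) / (4 * real n))) \<le> 1" by simp
    then have "real ((2 * n) choose n) * exp (- (real ?k * (real ?k - 1) / (4 * real n)))
       \<le> real ((2 * n) choose n) * 1" by (intro mult_left_mono) auto
    from order_trans[OF central_binomial_decay this] False
    have "real (card M) * 2 ^ ?k \<le> real (card (half_subsets B))"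
      unfolding cM half by simp
    then show ?thesis by (simp add: field_simps)
  qed
  assume k2: "card F \<ge> 2"
  let ?k = "real (card F)"
  have "card F \<le> card B" by (rule card_mono[OF assms(1,3)])
  then have n0: "n > 0" using n k2 by auto
  define x where "x = ?k * (?k - 1) / (4 * real n)"
  have x0: "x > 0" unfolding x_def using k2 n0 by simp
  have "x \<le> exp x" using exp_ge_add_one_self[of x] by linarith
  then have "exp (- x) \<le> 1 / x" using x0 by (simp add: exp_minus field_simps)
  also have "1 / x \<le> 4 * real (card B) / ?k ^ 2"
  proof -
    have "?k ^ 2 \<le> 2 * (?k * (?k - 1))" using k2 by (simp add: power2_eq_square algebra_simps)
    then have "4 * real n * ?k ^ 2 \<le> 4 * real n * (2 * (?k * (?k - 1)))"
      by (rule mult_left_mono) simp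
    then show ?thesis unfolding x_def n using k2 n0 by (simp add: field_simps)
  qed
  finally have "real ((2 * n) choose n) * exp (- x) \<le> real ((2 * n) choose n) * (4 * real (card B) / ?k ^ 2)"
    by (intro mult_left_mono) auto
  then have "real (card M) * 2 ^ card F \<le> real (card (half_subsets B)) * (4 * real (card B) / ?k ^ 2)"
    using central_binomial_decay[OF n0, of "card F"] cM half by (simp add: x_def)
  from mult_right_mono[OF this, of "(1 / 2) ^ card F"]
  show "real (card M) \<le> real (card (half_subsets B)) * (1 / 2) ^ card F * (4 * real (card B) / ?k ^ 2)"
    by (simp add: power_one_over algebra_simps)
qed

subsection \<open>Balanced colorings of a graph\<close>

locale fgraph =
  fixes V :: "'a set" and E :: "'a set set"
  assumes finV: "finite V" and edge: "\<And>e. e \<in> E \<Longrightarrow> e \<subseteq> V \<and> card e = 2"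
begin

section \<open>Degrees and the number of edges\<close>

definition nb :: "'a \<Rightarrow> 'a set" where "nb v = {w. {v, w} \<in> E}"

lemma finE: "finite E"
  using edge by (intro finite_subset[OF _ finite_Pow_iff[THEN iffD2, OF finV]]) auto

lemma nb_subset: "nb v \<subseteq> V"
  using edge unfolding nb_def by auto

lemma fin_nb: "finite (nb v)"
  using nb_subset finV by (rule finite_subset)

lemma sum_nb: "(\<Sum>v\<in>V. card (nb v)) = 2 * card E"
proof -
  have "card (nb v) = card {e \<in> E. v \<in> e}" for v
  proof (rule bij_betw_same_card[of "\<lambda>w. {v, w}"], unfold bij_betw_def, intro conjI)
    show "inj_on (\<lambda>w. {v, w}) (nb v)" by (auto simp: inj_on_def doubleton_eq_iff)
    show "(\<lambda>w. {v, w}) ` nb v = {e \<in> E. v \<in> e}"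
    proof (intro equalityI subsetI)
      fix e assume e: "e \<in> {e \<in> E. v \<in> e}"
      then have "card e = 2" using edge by auto
      then obtain x y where "e = {x, y}" by (auto simp: card_2_iff)
      then have "e = {v, x} \<or> e = {v, y}" using e by auto
      then show "e \<in> (\<lambda>w. {v, w}) ` nb v" using e unfolding nb_def by auto
    qed (auto simp: nb_def)
  qed
  moreover have "(\<Sum>v\<in>V. card {e \<in> E. v \<in> e}) = 2 * card E"
  proof (rule sum_multicount[OF finV finE], intro ballI)
    fix e assume "e \<in> E"
    then have "{v \<in> V. v \<in> e} = e" "card e = 2" using edge by auto
    then show "card {v \<in> V. v \<in> e} = 2" by simp
  qed
  ultimately show ?thesis by simp
qed

text \<open>Markov's inequality for the degrees, whose sum is \<open>2 * card E\<close>.\<close>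

lemma card_large_degree: 
  assumes "0 \<le> D"
  shows "real (card {v \<in> V. D \<le> real (card (nb v))}) * D \<le> 2 * real (card E)"
proof -
  let ?W = "{v \<in> V. D \<le> real (card (nb v))}"
  have "real (card ?W) * D = (\<Sum>v\<in>?W. D)" by simp
  also have "\<dots> \<le> (\<Sum>v\<in>?W. real (card (nb v)))" by (rule sum_mono) auto
  also have "\<dots> \<le> (\<Sum>v\<in>V. real (card (nb v)))" using finV by (intro sum_mono2) auto
  also have "\<dots> = 2 * real (card E)" using sum_nb by (metis of_nat_mult of_nat_numeral of_nat_sum)
  finally show ?thesis .
qed

text \<open>An edge between \<open>X\<close> and its complement is owned by the endpoint outside \<open>X\<close>,
  so a vertex outside \<open>X\<close> colors all of its edges to \<open>X\<close> in a balanced way.\<close>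
definition owner :: "'a set \<Rightarrow> 'a set \<Rightarrow> 'a" where
  "owner X e = (SOME v. v \<in> e \<and> (v \<in> X \<longrightarrow> e \<subseteq> X))"

definition own :: "'a set \<Rightarrow> 'a \<Rightarrow> 'a set set" where
  "own X v = {e \<in> E. owner X e = v}"

text \<open>The empty set is never an edge; it pads an odd number of edges to an even one.\<close>
definition pad :: "'a set \<Rightarrow> 'a \<Rightarrow> 'a set set" where
  "pad X v = (if even (card (own X v)) then own X v else insert {} (own X v))"

text \<open>A coloring is stored as the red half chosen by each vertex: an edge \<open>e\<close> is
  red under \<open>f\<close> when \<open>e \<in> f (owner X e)\<close>. Counting in this product set
  replaces probabilities.\<close>

definition colorings :: "'a set \<Rightarrow> ('a \<Rightarrow> 'a set set) set" where
  "colorings X = (\<Pi>\<^sub>E v\<in>V. half_subsets (pad X v))"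

definition bad :: "'a set \<Rightarrow> bool \<Rightarrow> 'a set \<Rightarrow> 'a set \<Rightarrow> ('a \<Rightarrow> 'a set set) set" where
  "bad X b S T = {f \<in> colorings X. \<forall>e\<in>bip S T. (e \<in> f (owner X e)) = b}"

definition sides :: "nat \<Rightarrow> nat \<Rightarrow> ('a set \<times> 'a set) set" where
  "sides s t = {(S, T). S \<subseteq> V \<and> T \<subseteq> V \<and> card S = s \<and> card T = t \<and> S \<inter> T = {} \<and> bip S T \<subseteq> E}"

text \<open>An admissible owner exists: an endpoint outside \<open>X\<close>, or any endpoint if the
  edge lies inside \<open>X\<close>.\<close>

lemma owner:
  assumes "e \<in> E"
  shows "owner X e \<in> e" and "owner X e \<in> X \<Longrightarrow> e \<subseteq> X"
proof -
  have "e \<noteq> {}" using edge[OF assms] by auto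
  then have "\<exists>v. v \<in> e \<and> (v \<in> X \<longrightarrow> e \<subseteq> X)" by blast
  from someI_ex[OF this] show "owner X e \<in> e" "owner X e \<in> X \<Longrightarrow> e \<subseteq> X"
    unfolding owner_def by auto
qed

lemma owner_in_V: "e \<in> E \<Longrightarrow> owner X e \<in> V"
  using owner(1) edge by blast

lemma fin_own: "finite (own X v)"
  using finE unfolding own_def by auto

lemma sum_own: "(\<Sum>v\<in>V. card (own X v)) = card E"
proof -
  have "(\<Sum>v\<in>V. card {e \<in> E. owner X e = v}) = 1 * card E"
  proof (rule sum_multicount[OF finV finE], intro ballI)
    fix e assume "e \<in> E"
    then have "{v \<in> V. owner X e = v} = {owner X e}" using owner_in_V by auto
    then show "card {v \<in> V. owner X e = v} = 1" by simp
  qed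
  then show ?thesis by (simp add: own_def)
qed

text \<open>The factor 2 suffices because an odd number of own edges is at least one.\<close>

lemma pad: "finite (pad X v)" "even (card (pad X v))" "own X v \<subseteq> pad X v"
  "card (pad X v) \<le> 2 * card (own X v)"
proof -
  have "{} \<notin> own X v" using edge unfolding own_def by force
  moreover have "card (own X v) > 0" if "odd (card (own X v))" using that by (auto intro: Nat.gr0I)
  ultimately show "finite (pad X v)" "even (card (pad X v))" "own X v \<subseteq> pad X v"
    "card (pad X v) \<le> 2 * card (own X v)"
    using fin_own[of X v] unfolding pad_def by (auto simp: Suc_le_eq)
qed

lemma fin_colorings: "finite (colorings X)"
  unfolding colorings_def half_subsets_def using finV pad(1) by (intro finite_PiE) auto

lemma colorings_pos: "card (colorings X) > 0"
proof -
  have "half_subsets (pad X v) \<noteq> {}" for v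
  proof -
    obtain n where n: "card (pad X v) = 2 * n" using pad(2)[of X v] by auto
    then obtain R where "R \<subseteq> pad X v" "card R = n"
      using obtain_subset_with_card_n[of n "pad X v"] by auto
    then show ?thesis using n unfolding half_subsets_def by auto
  qed
  then have "colorings X \<noteq> {}" unfolding colorings_def PiE_eq_empty_iff by blast
  then show ?thesis using fin_colorings by (simp add: card_gt_0_iff)
qed

section \<open>Probability that a given copy is monochromatic\<close>

text \<open>The vertices choose their halves independently, so the count is a product. Every edge of
  the copy has one owner, hence the exponents of 1/2 add up to \<open>s * t\<close>. The weight
  \<open>W v\<close> records what vertex \<open>v\<close> gains over fully independent
  edges.\<close>

lemma card_bad_le:
  assumes "(S, T) \<in> sides s t"
    and W: "\<And>v. v \<in> V \<Longrightarrow> real (card {R \<in> half_subsets (pad X v). \<forall>e\<in>bip S T \<inter> own X v. (e \<in> R) = b})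
      \<le> real (card (half_subsets (pad X v))) * (1 / 2) ^ card (bip S T \<inter> own X v) * W v"
  shows "real (card (bad X b S T)) \<le> real (card (colorings X)) * (1 / 2) ^ (s * t) * (\<Prod>v\<in>V. W v)"
proof -
  let ?M = "\<lambda>v. {R \<in> half_subsets (pad X v). \<forall>e\<in>bip S T \<inter> own X v. (e \<in> R) = b}"
  have ST: "bip S T \<subseteq> E" "card S = s" "card T = t" "S \<inter> T = {}" "finite S" "finite T"
    using assms(1) finV unfolding sides_def by (auto intro: finite_subset)
  have fin: "finite (bip S T)" using ST by (simp add: finite_bip)
  have "bad X b S T = (\<Pi>\<^sub>E v\<in>V. ?M v)"
  proof (intro equalityI subsetI)
    fix f assume "f \<in> bad X b S T"
    then show "f \<in> (\<Pi>\<^sub>E v\<in>V. ?M v)"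
      unfolding bad_def colorings_def own_def by (auto simp: PiE_iff)
  next
    fix f assume f: "f \<in> (\<Pi>\<^sub>E v\<in>V. ?M v)"
    have "(e \<in> f (owner X e)) = b" if "e \<in> bip S T" for e
    proof -
      have "owner X e \<in> V" "e \<in> own X (owner X e)"
        using that ST owner_in_V unfolding own_def by auto
      then show ?thesis using f that by (auto simp: PiE_iff)
    qed
    then show "f \<in> bad X b S T" using f unfolding bad_def colorings_def by (auto simp: PiE_iff)
  qed
  then have "real (card (bad X b S T)) = (\<Prod>v\<in>V. real (card (?M v)))"
    using finV by (simp add: card_PiE)
  also have "\<dots> \<le> (\<Prod>v\<in>V. real (card (half_subsets (pad X v))) * (1 / 2) ^ card (bip S T \<inter> own X v) * W v)"
    using W by (intro prod_mono) auto
  also have "\<dots> = real (card (colorings X)) * (\<Prod>v\<in>V. (1 / 2) ^ card (bip S T \<inter> own X v)) * (\<Prod>v\<in>V. W v)"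
    using finV by (simp add: prod.distrib colorings_def card_PiE)
  also have "(\<Prod>v\<in>V. (1 / 2 :: real) ^ card (bip S T \<inter> own X v)) = (1 / 2) ^ (s * t)"
  proof -
    have "(\<Sum>v\<in>V. card {e \<in> bip S T. owner X e = v}) = 1 * card (bip S T)"
    proof (rule sum_multicount[OF finV fin], intro ballI)
      fix e assume "e \<in> bip S T"
      then have "{v \<in> V. owner X e = v} = {owner X e}" using owner_in_V ST by auto
      then show "card {v \<in> V. owner X e = v} = 1" by simp
    qed
    moreover have "bip S T \<inter> own X v = {e \<in> bip S T. owner X e = v}" for v
      using ST unfolding own_def by auto
    ultimately have "(\<Sum>v\<in>V. card (bip S T \<inter> own X v)) = s * t" using ST by (simp add: card_bip)
    then show ?thesis by (metis power_sum)
  qed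
  finally show ?thesis .
qed

lemma card_bad_le_uniform:
  assumes "(S, T) \<in> sides s t"
  shows "real (card (bad X b S T)) \<le> real (card (colorings X)) * (1 / 2) ^ (s * t)"
proof -
  have "real (card {R \<in> half_subsets (pad X v). \<forall>e\<in>bip S T \<inter> own X v. (e \<in> R) = b})
      \<le> real (card (half_subsets (pad X v))) * (1 / 2) ^ card (bip S T \<inter> own X v) * 1" for v
    using half_subsets_prescribed(1)[OF pad(1,2), of "bip S T \<inter> own X v" X v b] pad(3) by auto
  from card_bad_le[OF assms this] show ?thesis by simp
qed

text \<open>A vertex of \<open>T\<close> outside \<open>X\<close> owns all of its \<open>s\<close>
  edges to \<open>S\<close>, so the stronger bound for halves applies to them. The constant 8 is 4,
  doubled by the padding.\<close>

lemma card_bad_le_weight: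
  assumes ST: "(S, T) \<in> sides s t" and "S \<subseteq> X" "s \<ge> 2"
  shows "real (card (bad X b S T)) \<le> real (card (colorings X)) * (1 / 2) ^ (s * t) *
    (\<Prod>v\<in>T. if v \<in> X then 1 else 8 * real (card (own X v)) / real s ^ 2)"
proof -
  let ?w = "\<lambda>v. if v \<in> X then 1 else 8 * real (card (own X v)) / real s ^ 2"
  let ?W = "\<lambda>v. if v \<in> T then ?w v else 1"
  have "real (card {R \<in> half_subsets (pad X v). \<forall>e\<in>bip S T \<inter> own X v. (e \<in> R) = b})
      \<le> real (card (half_subsets (pad X v))) * (1 / 2) ^ card (bip S T \<inter> own X v) * ?W v" for v
  proof (cases "v \<in> T - X")
    case False
    then have "?W v = 1" by auto
    then show ?thesis
      using half_subsets_prescribed(1)[OF pad(1,2), of "bip S T \<inter> own X v" X v b] pad(3) by auto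
  next
    case True
    have E: "{u, v} \<in> E" if "u \<in> S" for u
      using ST True that unfolding sides_def bip_def by blast
    \<comment> \<open>If \<open>u\<close> were the owner, then \<open>u \<in> X\<close> would force
      the whole edge into \<open>X\<close>, but \<open>v\<close> lies outside.\<close>
    have own: "owner X {u, v} = v" if "u \<in> S" for u
      using owner[OF E[OF that], of X] True that assms(2) by auto
    have "bip S T \<inter> own X v = (\<lambda>u. {u, v}) ` S"
    proof (intro equalityI subsetI)
      fix e assume e: "e \<in> bip S T \<inter> own X v"
      then obtain u v' where "u \<in> S" "v' \<in> T" "e = {u, v'}" unfolding bip_def by auto
      moreover have "v \<in> e" using e owner(1) unfolding own_def by blast
      moreover have "v \<notin> S" using True assms(2) by auto
      ultimately show "e \<in> (\<lambda>u. {u, v}) ` S" by auto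
    next
      fix e assume "e \<in> (\<lambda>u. {u, v}) ` S"
      then show "e \<in> bip S T \<inter> own X v" using own E True unfolding own_def bip_def by auto
    qed
    moreover have "inj_on (\<lambda>u. {u, v}) S" by (auto simp: inj_on_def doubleton_eq_iff)
    ultimately have c: "card (bip S T \<inter> own X v) = s"
      using ST by (simp add: card_image sides_def)
    have "real (card {R \<in> half_subsets (pad X v). \<forall>e\<in>bip S T \<inter> own X v. (e \<in> R) = b})
      \<le> real (card (half_subsets (pad X v))) * (1 / 2) ^ s * (4 * real (card (pad X v)) / real s ^ 2)"
      using half_subsets_prescribed(2)[OF pad(1,2), of "bip S T \<inter> own X v" X v b] pad(3) c assms(3) by auto
    also have "\<dots> \<le> real (card (half_subsets (pad X v))) * (1 / 2) ^ s * (8 * real (card (own X v)) / real s ^ 2)"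
      using pad(4)[of X v] by (intro mult_left_mono divide_right_mono) auto
    finally show ?thesis using True c by simp
  qed
  from card_bad_le[OF ST this] have "real (card (bad X b S T))
    \<le> real (card (colorings X)) * (1 / 2) ^ (s * t) * (\<Prod>v\<in>V. ?W v)" .
  also have "(\<Prod>v\<in>V. ?W v) = (\<Prod>v\<in>T. ?w v)"
  proof -
    have "T \<subseteq> V" using ST unfolding sides_def by auto
    then show ?thesis using finV by (simp add: prod.If_cases inf.absorb2)
  qed
  finally show ?thesis .
qed

section \<open>Union bound over copies and colors\<close>

lemma fin_sides: "finite (sides s t)"
  by (rule finite_subset[of _ "Pow V \<times> Pow V"]) (auto simp: sides_def finV)

text \<open>The hypothesis asks for half of the colorings because each of the two colors contributes
  its own sum.\<close>

lemma sum_bad_imp_coloring: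
  assumes "\<And>b. (\<Sum>(S, T)\<in>sides s t. real (card (bad X b S T))) < real (card (colorings X)) / 2"
  shows "\<exists>col. \<forall>(S, T)\<in>sides s t. \<forall>b::bool. \<exists>e\<in>bip S T. col e \<noteq> b"
proof -
  let ?B = "\<Union>b::bool. \<Union>(S, T)\<in>sides s t. bad X b S T"
  have c: "card (\<Union>(S, T)\<in>sides s t. bad X b S T) \<le> (\<Sum>(S, T)\<in>sides s t. card (bad X b S T))" for b
    using card_UN_le[OF fin_sides, of "\<lambda>(S, T). bad X b S T" s t] by (simp add: case_prod_unfold)
  have "card ?B \<le> (\<Sum>b\<in>UNIV. card (\<Union>(S, T)\<in>sides s t. bad X b S T))"
    by (rule card_UN_le) simp
  also have "\<dots> \<le> (\<Sum>b\<in>UNIV. \<Sum>(S, T)\<in>sides s t. card (bad X b S T))"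
    by (rule sum_mono) (rule c)
  finally have "real (card ?B) \<le> real (\<Sum>b\<in>UNIV. \<Sum>(S, T)\<in>sides s t. card (bad X b S T))"
    by (rule of_nat_mono)
  also have "\<dots> = (\<Sum>b\<in>UNIV. \<Sum>(S, T)\<in>sides s t. real (card (bad X b S T)))"
    by (simp add: case_prod_unfold)
  also have "\<dots> < real (card (colorings X))"
    using assms[of True] assms[of False] by (simp add: UNIV_bool)
  finally have "card ?B < card (colorings X)" by simp
  moreover have "?B \<subseteq> colorings X" unfolding bad_def by auto
  ultimately obtain f where f: "f \<in> colorings X" "f \<notin> ?B" by (metis subsetI subset_antisym less_irrefl)
  show ?thesis
  proof (intro exI[of _ "\<lambda>e. e \<in> f (owner X e)"] ballI, clarify)
    fix S T b assume "(S, T) \<in> sides s t"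
    then have "f \<notin> bad X b S T" using f by auto
    then show "\<exists>e\<in>bip S T. (e \<in> f (owner X e)) \<noteq> b" using f unfolding bad_def by auto
  qed
qed

section \<open>Bounds for three classes of copies\<close>

lemma sides_nb:
  assumes "(S, T) \<in> sides s t"
  shows "u \<in> S \<Longrightarrow> T \<subseteq> nb u" and "v \<in> T \<Longrightarrow> S \<subseteq> nb v"
proof -
  have E: "{u, v} \<in> E" if "u \<in> S" "v \<in> T" for u v
    using assms that unfolding sides_def bip_def by blast
  have E': "{v, u} \<in> E" if "u \<in> S" "v \<in> T" for u v
    using E[OF that] by (simp only: insert_commute)
  show "u \<in> S \<Longrightarrow> T \<subseteq> nb u" unfolding nb_def using E by blast
  show "v \<in> T \<Longrightarrow> S \<subseteq> nb v" unfolding nb_def using E' by blast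
qed

text \<open>The choice of \<open>S\<close> costs \<open>card X ^ s\<close>. The weights of
  \<open>T\<close> are summed by \<open>sum_prod_subsets_le\<close>; since every edge is owned once,
  they total at most \<open>card X\<close> plus \<open>8 * card E / s ^ 2\<close>. This is where the
  factor \<open>s ^ 2\<close> is gained.\<close>

lemma sum_bad_inside:
  assumes "X \<subseteq> V" "s \<ge> 2"
  shows "(\<Sum>(S, T)\<in>{(S, T) \<in> sides s t. S \<subseteq> X}. real (card (bad X b S T))) * real t ^ t
    \<le> real (card (colorings X)) * (1 / 2) ^ (s * t) * real (card X) ^ s *
      (3 * (real (card X) + 8 * real (card E) / real s ^ 2)) ^ t"
proof -
  let ?w = "\<lambda>v. if v \<in> X then 1 else 8 * real (card (own X v)) / real s ^ 2"
  let ?P = "{(S, T) \<in> sides s t. S \<subseteq> X}"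
  let ?SS = "{S. S \<subseteq> X \<and> card S = s}" and ?TT = "{T. T \<subseteq> V \<and> card T = t}"
  let ?c = "real (card (colorings X)) * (1 / 2) ^ (s * t)"
  define p where "p = (\<Sum>T\<in>?TT. \<Prod>v\<in>T. ?w v)"
  have finX: "finite X" using assms finV by (auto intro: finite_subset)
  have fin: "finite ?SS" "finite ?TT" using finX finV by auto
  have w0: "0 \<le> ?w v" for v by simp
  have p0: "0 \<le> p" unfolding p_def by (intro sum_nonneg prod_nonneg ballI w0)
  have "(\<Sum>(S, T)\<in>?P. real (card (bad X b S T))) \<le> (\<Sum>(S, T)\<in>?P. ?c * (\<Prod>v\<in>T. ?w v))"
    using card_bad_le_weight assms by (intro sum_mono) auto
  \<comment> \<open>Dropping adjacency and disjointness decouples the sum over \<open>S\<close> from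
    the sum over \<open>T\<close>.\<close>
  also have "\<dots> \<le> (\<Sum>(S, T)\<in>?SS \<times> ?TT. ?c * (\<Prod>v\<in>T. ?w v))"
  proof (rule sum_mono2)
    show "finite (?SS \<times> ?TT)" using fin by simp
    show "?P \<subseteq> ?SS \<times> ?TT" unfolding sides_def by auto
    fix x assume "x \<in> ?SS \<times> ?TT - ?P"
    show "0 \<le> (case x of (S, T) \<Rightarrow> ?c * (\<Prod>v\<in>T. ?w v))"
      using w0 by (auto intro!: mult_nonneg_nonneg prod_nonneg split: prod.split)
  qed
  also have "\<dots> = (\<Sum>S\<in>?SS. \<Sum>T\<in>?TT. ?c * (\<Prod>v\<in>T. ?w v))"
    by (rule sum.cartesian_product[symmetric])
  also have "(\<Sum>T\<in>?TT. ?c * (\<Prod>v\<in>T. ?w v)) = ?c * p"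
    unfolding p_def by (rule sum_distrib_left[symmetric])
  also have "(\<Sum>S\<in>?SS. ?c * p) = ?c * real (card ?SS) * p" by simp
  also have "\<dots> \<le> ?c * real (card X) ^ s * p"
    using card_subsets_le_power[OF finX, of s] p0
    by (intro mult_right_mono mult_left_mono) (auto simp flip: of_nat_power)
  finally have 1: "(\<Sum>(S, T)\<in>?P. real (card (bad X b S T))) \<le> ?c * real (card X) ^ s * p" .
  have "p * real t ^ t \<le> p * (3 ^ t * fact t)"
    using p0 by (intro mult_left_mono power_le_3_power_fact)
  also have "\<dots> = 3 ^ t * (p * fact t)" by simp
  also have "\<dots> \<le> 3 ^ t * (\<Sum>v\<in>V. ?w v) ^ t"
    unfolding p_def by (intro mult_left_mono sum_prod_subsets_le finV) auto
  also have "\<dots> = (3 * (\<Sum>v\<in>V. ?w v)) ^ t" by (simp add: power_mult_distrib)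
  also have "\<dots> \<le> (3 * (real (card X) + 8 * real (card E) / real s ^ 2)) ^ t"
  proof (intro power_mono mult_left_mono)
    have "(\<Sum>v\<in>V. ?w v) \<le> (\<Sum>v\<in>V. (if v \<in> X then 1 else 0) + 8 * real (card (own X v)) / real s ^ 2)"
      by (intro sum_mono) auto
    also have "\<dots> = real (card X) + (\<Sum>v\<in>V. 8 * real (card (own X v)) / real s ^ 2)"
      using finV assms(1) by (simp add: sum.distrib sum.If_cases inf.absorb2)
    also have "(\<Sum>v\<in>V. 8 * real (card (own X v)) / real s ^ 2) = 8 * real (\<Sum>v\<in>V. card (own X v)) / real s ^ 2"
      by (simp add: sum_distrib_left sum_divide_distrib)
    finally show "(\<Sum>v\<in>V. ?w v) \<le> real (card X) + 8 * real (card E) / real s ^ 2"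
      by (simp add: sum_own)
    show "0 \<le> 3 * (\<Sum>v\<in>V. ?w v)" by (intro mult_nonneg_nonneg sum_nonneg) auto
  qed auto
  finally have 2: "p * real t ^ t \<le> (3 * (real (card X) + 8 * real (card E) / real s ^ 2)) ^ t" .
  have "(\<Sum>(S, T)\<in>?P. real (card (bad X b S T))) * real t ^ t \<le> ?c * real (card X) ^ s * (p * real t ^ t)"
    using mult_right_mono[OF 1, of "real t ^ t"] by (simp add: mult.assoc)
  also have "\<dots> \<le> ?c * real (card X) ^ s * (3 * (real (card X) + 8 * real (card E) / real s ^ 2)) ^ t"
    using 2 by (intro mult_left_mono) auto
  finally show ?thesis .
qed

lemma card_nonisolated: "card {v \<in> V. card (nb v) > 0} \<le> 2 * card E"
proof -
  have "{v \<in> V. card (nb v) > 0} = {v \<in> V. (1::real) \<le> real (card (nb v))}" by auto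
  then show ?thesis using card_large_degree[of 1] by simp
qed

text \<open>Pick a non-isolated \<open>u\<close> of \<open>S\<close> outside \<open>X\<close>, then
  \<open>T\<close> inside the neighborhood of \<open>u\<close>, then \<open>S\<close> inside the
  neighborhood of a low-degree vertex of \<open>T\<close>. The three factors on the right bound
  these choices in this order.\<close>

lemma card_sides_low:
  assumes "s > 0" "t > 0" "0 \<le> \<Delta>" "\<And>u. u \<in> V - X \<Longrightarrow> real (card (nb u)) \<le> \<Delta>"
  shows "real (card {(S, T) \<in> sides s t. \<not> S \<subseteq> X \<and> (\<exists>v\<in>T. card (nb v) \<le> D)}) * real t ^ t
    \<le> 2 * real (card E) * (3 * \<Delta>) ^ t * real D ^ s"
proof -
  let ?P = "{(S, T) \<in> sides s t. \<not> S \<subseteq> X \<and> (\<exists>v\<in>T. card (nb v) \<le> D)}"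
  let ?U = "{u \<in> V - X. card (nb u) > 0}"
  let ?TT = "\<lambda>u. {T. T \<subseteq> nb u \<and> card T = t}"
  \<comment> \<open>A fixed choice per \<open>T\<close> saves a factor \<open>t\<close>. If
    \<open>T\<close> has no low-degree vertex, \<open>z T\<close> is arbitrary, and the guard in
    \<open>?SS\<close> still leaves at most \<open>D ^ s\<close> sets.\<close>
  define z where "z T = (SOME v. v \<in> T \<and> card (nb v) \<le> D)" for T
  let ?SS = "\<lambda>T. if card (nb (z T)) \<le> D then {S. S \<subseteq> nb (z T) \<and> card S = s} else {}"
  let ?Q = "\<Union>u\<in>?U. \<Union>T\<in>?TT u. (\<lambda>S. (S, T)) ` ?SS T"
  have "?P \<subseteq> ?Q"
  proof
    fix x assume xP: "x \<in> ?P"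
    obtain S T where x: "x = (S, T)" by (cases x)
    from xP have ST: "(S, T) \<in> sides s t" and "\<not> S \<subseteq> X" "\<exists>v\<in>T. card (nb v) \<le> D"
      by (simp_all add: x)
    then obtain u v where u: "u \<in> S" "u \<notin> X" and v: "v \<in> T" "card (nb v) \<le> D" by blast
    have "z T \<in> T \<and> card (nb (z T)) \<le> D" 
      unfolding z_def by (rule someI[of "\<lambda>v. v \<in> T \<and> card (nb v) \<le> D", OF conjI[OF v]])
    moreover from this have "S \<in> ?SS T" using sides_nb(2)[OF ST] ST unfolding sides_def by auto
    moreover have "T \<in> ?TT u" using sides_nb(1)[OF ST u(1)] ST unfolding sides_def by auto
    moreover have "u \<in> ?U"
    proof -
      have "v \<in> nb u" using sides_nb(1)[OF ST u(1)] v by auto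
      then have "card (nb u) > 0" using fin_nb card_gt_0_iff by blast
      then show ?thesis using u ST unfolding sides_def by auto
    qed
    ultimately show "x \<in> ?Q" unfolding x by blast
  qed
  have finU: "finite ?U" using finV by auto
  have finT: "finite (?TT u)" for u using fin_nb by auto
  have finS: "finite (?SS T)" for T using fin_nb by auto
  have cS: "card (?SS T) \<le> D ^ s" for T
    using card_subsets_le_power[OF fin_nb, of "z T" s] power_mono[of "card (nb (z T))" D s] by auto
  have cT: "real (card (?TT u)) * real t ^ t \<le> (3 * \<Delta>) ^ t" if "u \<in> ?U" for u
  proof -
    have "real (card (?TT u)) * real t ^ t \<le> (3 * real (card (nb u))) ^ t"
      by (rule card_subsets_le_power_div[OF fin_nb])
    also have "\<dots> \<le> (3 * \<Delta>) ^ t" using assms(4)[of u] that by (intro power_mono) auto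
    finally show ?thesis .
  qed
  have cQ: "card (\<Union>T\<in>?TT u. (\<lambda>S. (S, T)) ` ?SS T) \<le> card (?TT u) * D ^ s" for u
  proof -
    have "card (\<Union>T\<in>?TT u. (\<lambda>S. (S, T)) ` ?SS T) \<le> (\<Sum>T\<in>?TT u. card ((\<lambda>S. (S, T)) ` ?SS T))"
      by (rule card_UN_le[OF finT])
    also have "\<dots> \<le> (\<Sum>T\<in>?TT u. D ^ s)"
      by (intro sum_mono order_trans[OF card_image_le[OF finS] cS])
    finally show ?thesis by simp
  qed
  have "finite ?Q" by (intro finite_UN_I finU finT finite_imageI finS)
  then have "card ?P \<le> card ?Q" using \<open>?P \<subseteq> ?Q\<close> by (rule card_mono)
  also have "\<dots> \<le> (\<Sum>u\<in>?U. card (\<Union>T\<in>?TT u. (\<lambda>S. (S, T)) ` ?SS T))"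
    by (rule card_UN_le[OF finU])
  also have "\<dots> \<le> (\<Sum>u\<in>?U. card (?TT u) * D ^ s)" by (rule sum_mono) (rule cQ)
  finally have "real (card ?P) \<le> real (\<Sum>u\<in>?U. card (?TT u) * D ^ s)" by (rule of_nat_mono)
  then have "real (card ?P) * real t ^ t \<le> (\<Sum>u\<in>?U. real (card (?TT u)) * real D ^ s) * real t ^ t"
    by (intro mult_right_mono) simp_all
  also have "\<dots> = (\<Sum>u\<in>?U. (real (card (?TT u)) * real t ^ t) * real D ^ s)"
    unfolding sum_distrib_right by (rule sum.cong) simp_all
  also have "\<dots> \<le> (\<Sum>u\<in>?U. (3 * \<Delta>) ^ t * real D ^ s)"
    by (intro sum_mono mult_right_mono cT) simp_all
  also have "\<dots> = real (card ?U) * ((3 * \<Delta>) ^ t * real D ^ s)" by simp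
  also have "\<dots> \<le> 2 * real (card E) * ((3 * \<Delta>) ^ t * real D ^ s)"
  proof (intro mult_right_mono)
    have "card ?U \<le> card {v \<in> V. card (nb v) > 0}" using finV by (intro card_mono) auto
    then show "real (card ?U) \<le> 2 * real (card E)" using card_nonisolated by simp
  qed (use assms in auto)
  finally show ?thesis by (simp add: mult.assoc)
qed

text \<open>Pick a vertex \<open>v\<close> of minimum degree d in \<open>T\<close>. Then
  \<open>S\<close> lies in its neighborhood, and \<open>T\<close> among the vertices of degree at
  least d, of which there are at most \<open>2 * card E\<close> / d.\<close>

lemma card_sides_high:
  assumes "s > 0" "2 * s \<le> t"
  shows "real (card {(S, T) \<in> sides s t. \<forall>v\<in>T. s ^ 4 < card (nb v)}) * real t ^ t
    \<le> 2 * real (card E) * (6 * real (card E) / real s ^ 2) ^ t"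
proof -
  let ?P = "{(S, T) \<in> sides s t. \<forall>v\<in>T. s ^ 4 < card (nb v)}"
  let ?U = "{v \<in> V. s ^ 4 < card (nb v)}"
  let ?W = "\<lambda>v. {w \<in> V. real (card (nb v)) \<le> real (card (nb w))}"
  let ?TT = "\<lambda>v. {T. T \<subseteq> ?W v \<and> card T = t}"
  let ?SS = "\<lambda>v. {S. S \<subseteq> nb v \<and> card S = s}"
  let ?Q = "\<Union>v\<in>?U. ?SS v \<times> ?TT v"
  have "?P \<subseteq> ?Q"
  proof clarify
    fix S T assume ST: "(S, T) \<in> sides s t" and hi: "\<forall>v\<in>T. s ^ 4 < card (nb v)"
    then have T: "T \<subseteq> V" "card T = t" "finite T" "card S = s" using finV unfolding sides_def by (auto intro: finite_subset)
    then have "T \<noteq> {}" using assms by auto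
    define v where "v = arg_min_on (\<lambda>v. card (nb v)) T"
    have v: "v \<in> T" "\<And>w. w \<in> T \<Longrightarrow> card (nb v) \<le> card (nb w)"
      unfolding v_def using arg_min_if_finite(1)[OF \<open>finite T\<close> \<open>T \<noteq> {}\<close>] arg_min_least[OF \<open>finite T\<close> \<open>T \<noteq> {}\<close>] by auto
    then have "v \<in> ?U" "T \<in> ?TT v" "S \<in> ?SS v" using T hi sides_nb(2)[OF ST] by auto
    then show "(S, T) \<in> ?Q" by blast
  qed
  have finU: "finite ?U" using finV by auto
  have finT: "finite (?TT v)" for v using finV by auto
  have finS: "finite (?SS v)" for v using fin_nb by auto
  have c: "real (card (?SS v)) * (real (card (?TT v)) * real t ^ t) \<le> (6 * real (card E) / real s ^ 2) ^ t"
    if v: "v \<in> ?U" for v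
  proof -
    define d where "d = card (nb v)"
    have d: "s ^ 4 \<le> d" "d > 0" using v by (auto simp: d_def)
    \<comment> \<open>Large degree pays for the choice of \<open>S\<close>:
      \<open>d ^ (t - s)\<close> is at least \<open>s ^ (4 * (t - s))\<close>, and
      \<open>2 * t \<le> 4 * (t - s)\<close> because \<open>2 * s \<le> t\<close>.\<close>
    have "(real s ^ 2) ^ t * real d ^ s \<le> real d ^ t"
    proof -
      have "(s ^ 2) ^ t = s ^ (2 * t)" by (simp add: power_mult)
      also have "\<dots> \<le> s ^ (4 * (t - s))" using assms by (intro power_increasing) auto
      also have "\<dots> = (s ^ 4) ^ (t - s)" by (simp add: power_mult)
      also have "\<dots> \<le> d ^ (t - s)" using d by (intro power_mono) auto
      finally have "(s ^ 2) ^ t * d ^ s \<le> d ^ (t - s) * d ^ s" by (rule mult_right_mono) simp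
      also have "\<dots> = d ^ t" using assms by (simp add: power_add[symmetric])
      finally show ?thesis by (metis of_nat_le_iff of_nat_mult of_nat_power)
    qed
    then have dd: "real d ^ s \<le> (real d / real s ^ 2) ^ t"
      using assms by (simp add: power_divide field_simps)
    have "real (card (?TT v)) * real t ^ t \<le> (3 * real (card (?W v))) ^ t"
      using finV by (intro card_subsets_le_power_div) auto
    also have "\<dots> \<le> (6 * real (card E) / real d) ^ t"
      using card_large_degree[of "real d"] d by (intro power_mono) (auto simp: d_def field_simps)
    finally have 1: "real (card (?TT v)) * real t ^ t \<le> (6 * real (card E) / real d) ^ t" .
    have "real (card (?SS v)) \<le> real d ^ s"
      using card_subsets_le_power[OF fin_nb, of v s] by (simp add: d_def flip: of_nat_power)
    also note dd
    finally have "real (card (?SS v)) * (real (card (?TT v)) * real t ^ t)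
      \<le> (real d / real s ^ 2) ^ t * (6 * real (card E) / real d) ^ t"
      using 1 by (intro mult_mono) auto
    also have "\<dots> = (6 * real (card E) / real s ^ 2) ^ t"
      using d by (simp add: power_mult_distrib[symmetric] mult.commute)
    finally show ?thesis .
  qed
  have "finite ?Q" by (intro finite_UN_I finU finite_cartesian_product finT finS)
  then have "card ?P \<le> card ?Q" using \<open>?P \<subseteq> ?Q\<close> by (rule card_mono)
  also have "\<dots> \<le> (\<Sum>v\<in>?U. card (?SS v \<times> ?TT v))" by (rule card_UN_le[OF finU])
  also have "\<dots> = (\<Sum>v\<in>?U. card (?SS v) * card (?TT v))" by (simp add: card_cartesian_product)
  finally have "real (card ?P) \<le> real (\<Sum>v\<in>?U. card (?SS v) * card (?TT v))" by (rule of_nat_mono)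
  then have "real (card ?P) * real t ^ t \<le> (\<Sum>v\<in>?U. real (card (?SS v)) * real (card (?TT v))) * real t ^ t"
    by (intro mult_right_mono) simp_all
  also have "\<dots> = (\<Sum>v\<in>?U. real (card (?SS v)) * (real (card (?TT v)) * real t ^ t))"
    by (simp add: sum_distrib_right mult.assoc)
  also have "\<dots> \<le> (\<Sum>v\<in>?U. (6 * real (card E) / real s ^ 2) ^ t)"
    using c by (rule sum_mono)
  also have "\<dots> = real (card ?U) * (6 * real (card E) / real s ^ 2) ^ t" by simp
  also have "\<dots> \<le> 2 * real (card E) * (6 * real (card E) / real s ^ 2) ^ t"
  proof (intro mult_right_mono)
    have "card ?U \<le> card {v \<in> V. card (nb v) > 0}" using finV by (intro card_mono) auto
    then show "real (card ?U) \<le> 2 * real (card E)" using card_nonisolated by simp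
  qed auto
  finally show ?thesis .
qed

text \<open>Three classes of copies cost an eighth of the colorings each, for either color, and 3/8
  is less than 1/2. The constant \<open>\<delta>\<close> is chosen so that
  \<open>16 * 3 * \<delta> * A ^ 4\<close> is 1/8, and \<open>c\<close> so that
  \<open>30 * c / \<delta>\<close> is \<open>1 / (8 * A ^ 2)\<close>; the powers of \<open>A\<close>
  absorb those of \<open>s ^ s\<close>.\<close>

lemma coloring_exists:
  fixes A c \<delta> :: real
  assumes s: "s \<ge> 2" "2 * s \<le> t" and A: "A \<ge> 1" "real s ^ s \<le> A ^ t"
    and \<delta>: "\<delta> = 1 / (384 * A ^ 4)" and c: "c = \<delta> / (240 * A ^ 2)"
    and m: "real (card E) \<le> c * real s ^ 2 * real t * 2 ^ s"
  shows "\<exists>col. \<forall>(S, T)\<in>sides s t. \<forall>b::bool. \<exists>e\<in>bip S T. col e \<noteq> b"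
proof -
  define \<Delta> where "\<Delta> = \<delta> * real t * 2 ^ s"
  define X where "X = {v \<in> V. \<Delta> \<le> real (card (nb v))}"
  define m where "m = real (card E)"
  have m0: "0 \<le> m" by (simp add: m_def)
  have m1: "m \<le> c * real s ^ 2 * real t * 2 ^ s" using m by (simp add: m_def)
  have A1: "1 \<le> A ^ k" for k using A by (simp add: one_le_power)
  have A0: "A > 0" using A by simp
  have \<delta>0: "\<delta> > 0" "\<delta> \<le> 1 / 384" using A1[of 4] A0 unfolding \<delta> by (auto simp: field_simps)
  have c0: "c > 0" "c \<le> \<delta> / 240" using A1[of 2] A0 \<delta>0 unfolding c by (auto simp: field_simps)
  have t0: "t > 0" and s0: "s > 0" using s by auto
  have \<Delta>0: "\<Delta> > 0" unfolding \<Delta>_def using \<delta>0 t0 by simp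
  have s2: "real s \<le> 2 ^ s" "real t \<le> 2 ^ t" by (simp_all add: of_nat_less_two_power less_imp_le)
  have s2t: "real s ^ 2 \<le> real t * 2 ^ s"
    unfolding power2_eq_square using s s2(1) by (intro mult_mono) auto
  \<comment> \<open>The choice of one vertex is affordable: \<open>2 * c \<le> 1\<close>, and
    \<open>s\<close> and \<open>t\<close> are at most \<open>2 ^ t\<close>.\<close>
  have m16: "2 * m \<le> 16 ^ t"
  proof -
    have "2 * m \<le> 1 * real s ^ 2 * real t * 2 ^ s"
      using m1 c0 \<delta>0 mult_right_mono[of "2 * c" 1 "real s ^ 2 * real t * 2 ^ s"] by (simp add: mult.assoc)
    also have "\<dots> \<le> 1 * (2 ^ t) ^ 2 * 2 ^ t * 2 ^ t"
      using s s2(2) by (intro mult_mono power_mono power_increasing order_trans[OF _ s2(2)]) auto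
    also have "\<dots> = (2 ^ 4) ^ t" by (simp only: power_mult[symmetric] power_add[symmetric] mult_1) (simp add: algebra_simps)
    finally show ?thesis by simp
  qed
  have m2: "m / real s ^ 2 \<le> c * real t * 2 ^ s" using m1 s0 by (simp add: field_simps)
  have half: "(1 / 2 :: real) ^ (s * t) = 1 / (2 ^ s) ^ t" by (simp add: power_one_over power_mult)
  define Om where "Om = real (card (colorings X))"
  have Om: "Om > 0" unfolding Om_def using colorings_pos by simp
  have cX: "real (card X) * \<Delta> \<le> 2 * m"
    unfolding X_def m_def using card_large_degree[of \<Delta>] \<Delta>0 by simp
  have cX2: "real (card X) \<le> 2 * c / \<delta> * real s ^ 2"
  proof -
    have "real (card X) * (\<delta> * real t * 2 ^ s) \<le> (2 * c * real s ^ 2) * (real t * 2 ^ s)"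
      using cX m1 by (simp add: \<Delta>_def algebra_simps)
    then have "(real (card X) * \<delta>) * (real t * 2 ^ s) \<le> (2 * c * real s ^ 2) * (real t * 2 ^ s)"
      by (simp add: mult.assoc)
    then have "real (card X) * \<delta> \<le> 2 * c * real s ^ 2"
      by (rule mult_right_le_imp_le) (use t0 in simp)
    then show ?thesis using \<delta>0 by (simp add: field_simps)
  qed
  have st: "real t ^ t > 0" using t0 by simp
  have ss: "(real s ^ k) ^ s \<le> (A ^ k) ^ t" for k
  proof -
    have "(real s ^ k) ^ s = (real s ^ s) ^ k" by (simp add: power_mult[symmetric] mult.commute)
    also have "\<dots> \<le> (A ^ t) ^ k" using A(2) by (intro power_mono) auto
    also have "\<dots> = (A ^ k) ^ t" by (simp add: power_mult[symmetric] mult.commute)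
    finally show ?thesis .
  qed
  txt \<open>Balanced coloring is only needed for \<open>?P1\<close>. In \<open>?P2\<close> the side \<open>T\<close> lies in
    a neighborhood of size at most \<open>\<Delta>\<close>, and a low-degree vertex of \<open>T\<close> leaves few choices
    for \<open>S\<close>; in \<open>?P3\<close> there are few choices for \<open>T\<close>.\<close>
  let ?P1 = "{(S, T) \<in> sides s t. S \<subseteq> X}"
  let ?P2 = "{(S, T) \<in> sides s t. \<not> S \<subseteq> X \<and> (\<exists>v\<in>T. card (nb v) \<le> s ^ 4)}"
  let ?P3 = "{(S, T) \<in> sides s t. \<forall>v\<in>T. s ^ 4 < card (nb v)}"
  \<comment> \<open>The powers of \<open>2 ^ s\<close> and \<open>t\<close> cancel against
    \<open>(1 / 2) ^ (s * t)\<close> and \<open>t ^ t\<close>, leaving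
    \<open>(1 / 8) ^ t\<close>.\<close>
  have small: "x \<le> Om / 8" if "x * real t ^ t \<le> Om * (1 / 2) ^ (s * t) * (2 ^ s * real t / 8) ^ t" for x
  proof -
    note that
    also have "Om * (1 / 2) ^ (s * t) * (2 ^ s * real t / 8) ^ t = Om * (1 / 8) ^ t * real t ^ t"
      unfolding half by (simp add: power_mult_distrib power_divide)
    finally have "x \<le> Om * (1 / 8) ^ t" by (rule mult_right_le_imp_le) (rule st)
    also have "\<dots> \<le> Om * (1 / 8) ^ 1" using Om t0 by (intro mult_left_mono power_decreasing) auto
    finally show ?thesis by simp
  qed
  have uniform: "(\<Sum>(S, T)\<in>P. real (card (bad X b S T))) \<le> Om / 8"
    if P: "P \<subseteq> sides s t" and le: "real (card P) * real t ^ t \<le> (2 ^ s * real t / 8) ^ t" for b P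
  proof (rule small)
    have "(\<Sum>(S, T)\<in>P. real (card (bad X b S T))) \<le> (\<Sum>(S, T)\<in>P. Om * (1 / 2) ^ (s * t))"
      using P card_bad_le_uniform unfolding Om_def by (intro sum_mono) auto
    also have "\<dots> = Om * (1 / 2) ^ (s * t) * real (card P)" by simp
    finally have "(\<Sum>(S, T)\<in>P. real (card (bad X b S T))) * real t ^ t
       \<le> Om * (1 / 2) ^ (s * t) * real (card P) * real t ^ t" by (rule mult_right_mono) simp
    also have "\<dots> = Om * (1 / 2) ^ (s * t) * (real (card P) * real t ^ t)" by simp
    also have "\<dots> \<le> Om * (1 / 2) ^ (s * t) * (2 ^ s * real t / 8) ^ t"
      using le Om by (intro mult_left_mono) auto
    finally show "(\<Sum>(S, T)\<in>P. real (card (bad X b S T))) * real t ^ t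
      \<le> Om * (1 / 2) ^ (s * t) * (2 ^ s * real t / 8) ^ t" .
  qed
  have P1: "(\<Sum>(S, T)\<in>?P1. real (card (bad X b S T))) \<le> Om / 8" for b
  proof (rule small)
    have X1: "real (card X) \<le> real s ^ 2"
    proof -
      have "2 * c / \<delta> * real s ^ 2 \<le> 1 * real s ^ 2"
        using c0 \<delta>0 by (intro mult_right_mono) (auto simp: field_simps)
      then show ?thesis using cX2 by linarith
    qed
    have "real (card X) ^ s \<le> (real s ^ 2) ^ s" using X1 by (intro power_mono) auto
    also have "\<dots> \<le> (A ^ 2) ^ t" by (rule ss)
    finally have X2: "real (card X) ^ s \<le> (A ^ 2) ^ t" .
    \<comment> \<open>In this factor \<open>card X\<close> is compared with
      \<open>t * 2 ^ s\<close>, keeping the small quotient \<open>c / \<delta>\<close>, so that it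
      merges with the edge term.\<close>
    have "3 * (real (card X) + 8 * m / real s ^ 2) \<le> 3 * (2 * c / \<delta> * (real t * 2 ^ s) + 8 * (c * real t * 2 ^ s))"
    proof -
      have "2 * c / \<delta> * real s ^ 2 \<le> 2 * c / \<delta> * (real t * 2 ^ s)"
        using s2t c0 \<delta>0 by (intro mult_left_mono) auto
      with cX2 have h: "real (card X) \<le> 2 * c / \<delta> * (real t * 2 ^ s)" by (rule order_trans)
      have "3 * (real (card X) + 8 * m / real s ^ 2) = 3 * (real (card X) + 8 * (m / real s ^ 2))" by simp
      also have "\<dots> \<le> 3 * (2 * c / \<delta> * (real t * 2 ^ s) + 8 * (c * real t * 2 ^ s))"
        by (intro mult_left_mono add_mono h m2) auto
      finally show ?thesis .
    qed
    also have "\<dots> = 3 * (2 * c / \<delta> + 8 * c) * (real t * 2 ^ s)" by (simp add: algebra_simps)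
    \<comment> \<open>As \<open>\<delta> \<le> 1\<close>, the bracket is at most
      \<open>10 * c / \<delta>\<close>.\<close>
    also have "\<dots> \<le> (30 * c / \<delta>) * (real t * 2 ^ s)"
      using c0 \<delta>0 by (intro mult_right_mono) (auto simp: field_simps)
    also have "30 * c / \<delta> = 1 / (8 * A ^ 2)" unfolding c using \<delta>0 A0 by (simp add: field_simps)
    finally have W: "3 * (real (card X) + 8 * m / real s ^ 2) \<le> 1 / (8 * A ^ 2) * (real t * 2 ^ s)" .
    have "(\<Sum>(S, T)\<in>?P1. real (card (bad X b S T))) * real t ^ t
      \<le> Om * (1 / 2) ^ (s * t) * real (card X) ^ s * (3 * (real (card X) + 8 * m / real s ^ 2)) ^ t"
      unfolding Om_def m_def using s by (intro sum_bad_inside) (auto simp: X_def)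
    also have "\<dots> \<le> Om * (1 / 2) ^ (s * t) * (A ^ 2) ^ t * (1 / (8 * A ^ 2) * (real t * 2 ^ s)) ^ t"
    proof (rule mult_mono)
      show "Om * (1 / 2) ^ (s * t) * real (card X) ^ s \<le> Om * (1 / 2) ^ (s * t) * (A ^ 2) ^ t"
        using X2 Om by (intro mult_left_mono) auto
      show "(3 * (real (card X) + 8 * m / real s ^ 2)) ^ t \<le> (1 / (8 * A ^ 2) * (real t * 2 ^ s)) ^ t"
        using W m0 by (intro power_mono) auto
    qed (use Om m0 in auto)
    also have "\<dots> = Om * (1 / 2) ^ (s * t) * (A ^ 2 * (1 / (8 * A ^ 2) * (real t * 2 ^ s))) ^ t"
      by (simp only: power_mult_distrib mult.assoc)
    also have "A ^ 2 * (1 / (8 * A ^ 2) * (real t * 2 ^ s)) = 2 ^ s * real t / 8"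
      using A0 by (simp add: field_simps)
    finally show "(\<Sum>(S, T)\<in>?P1. real (card (bad X b S T))) * real t ^ t
      \<le> Om * (1 / 2) ^ (s * t) * (2 ^ s * real t / 8) ^ t" .
  qed
  have P2: "(\<Sum>(S, T)\<in>?P2. real (card (bad X b S T))) \<le> Om / 8" for b
  proof (rule uniform)
    have "real (card ?P2) * real t ^ t \<le> 2 * m * (3 * \<Delta>) ^ t * real (s ^ 4) ^ s"
      unfolding m_def using s0 t0 \<Delta>0 by (intro card_sides_low) (auto simp: X_def)
    also have "\<dots> \<le> 16 ^ t * (3 * \<Delta>) ^ t * (A ^ 4) ^ t"
      using m16 ss[of 4] \<Delta>0 by (intro mult_mono) auto
    also have "\<dots> = (16 * (3 * \<Delta>) * A ^ 4) ^ t" by (simp only: power_mult_distrib)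
    also have "16 * (3 * \<Delta>) * A ^ 4 = 2 ^ s * real t / 8"
      unfolding \<Delta>_def \<delta> using A0 by (simp add: field_simps)
    finally show "real (card ?P2) * real t ^ t \<le> (2 ^ s * real t / 8) ^ t" .
  qed auto
  have P3: "(\<Sum>(S, T)\<in>?P3. real (card (bad X b S T))) \<le> Om / 8" for b
  proof (rule uniform)
    have "real (card ?P3) * real t ^ t \<le> 2 * m * (6 * m / real s ^ 2) ^ t"
      unfolding m_def using s0 s by (intro card_sides_high) auto
    also have "\<dots> \<le> 16 ^ t * (6 * (c * real t * 2 ^ s)) ^ t"
      using m16 m2 m0 by (intro mult_mono power_mono) auto
    also have "\<dots> = (16 * (6 * (c * real t * 2 ^ s))) ^ t" by (simp only: power_mult_distrib)
    also have "\<dots> \<le> (2 ^ s * real t / 8) ^ t"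
    proof (rule power_mono)
      have "96 * c * (real t * 2 ^ s) \<le> 1 / 8 * (real t * 2 ^ s)"
        using c0 \<delta>0 by (intro mult_right_mono) auto
      then show "16 * (6 * (c * real t * 2 ^ s)) \<le> 2 ^ s * real t / 8" by (simp add: algebra_simps)
    qed (use c0 in auto)
    finally show "real (card ?P3) * real t ^ t \<le> (2 ^ s * real t / 8) ^ t" .
  qed auto
  show ?thesis
  proof (rule sum_bad_imp_coloring)
    fix b
    let ?g = "\<lambda>(S, T). real (card (bad X b S T))"
    have fin: "finite ?P1" "finite ?P2" "finite ?P3"
      by (auto intro: finite_subset[OF _ fin_sides[of s t]])
    \<comment> \<open>The first and third classes may overlap, so subadditivity is used instead of a
      disjoint union.\<close>
    have un: "sum ?g (P \<union> Q) \<le> sum ?g P + sum ?g Q" if "finite P" "finite Q" for P Q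
      using sum.union_inter[OF that, of ?g] sum_nonneg[of "P \<inter> Q" ?g] by (auto simp: case_prod_unfold)
    have "sum ?g (sides s t) \<le> sum ?g (?P1 \<union> (?P2 \<union> ?P3))"
      using fin by (intro sum_mono2) (auto simp: not_less)
    also have "\<dots> \<le> Om / 8 + (Om / 8 + Om / 8)"
      using un[of ?P1 "?P2 \<union> ?P3"] un[of ?P2 ?P3] P1[of b] P2[of b] P3[of b] fin by simp
    also have "\<dots> < Om / 2" using Om by simp
    finally show "sum ?g (sides s t) < real (card (colorings X)) / 2" unfolding Om_def .
  qed
qed

end

subsection \<open>Bounds on the size Ramsey number\<close>

text \<open>For k < s the ratio (2s^2 - k) / (s^2 - k) is at most 2(s + 1) / s; the induction
  multiplies these ratios.\<close>

lemma binomial_double_le: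
  assumes "k \<le> s"
  shows "real ((2 * s\<^sup>2) choose k) * real s ^ k \<le> (2 * (real s + 1)) ^ k * real (s\<^sup>2 choose k)"
  using assms
proof (induction k)
  case (Suc k)
  have step: "real (Suc k) * real (N choose Suc k) = (real N - real k) * real (N choose k)" if "k \<le> N" for N
  proof -
    have "Suc k * (N choose Suc k) = (N - k) * (N choose k)"
      by (simp only: binomial_absorption binomial_absorb_comp)
    then have "real (Suc k) * real (N choose Suc k) = real (N - k) * real (N choose k)"
      by (metis of_nat_mult)
    then show ?thesis using that by (simp add: of_nat_diff)
  qed
  have "s \<le> s\<^sup>2" by (cases s) (auto simp: power2_eq_square)
  then have ks: "k \<le> s\<^sup>2" "k \<le> 2 * s\<^sup>2" using Suc.prems by linarith+
  \<comment> \<open>After expansion, \<open>key\<close> says exactly that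
    \<open>k * (s + 2) \<le> 2 * s\<^sup>2\<close>.\<close>
  have "real k * (real s + 2) \<le> (real s - 1) * (real s + 2)" using Suc.prems by (intro mult_right_mono) auto
  also have "\<dots> \<le> 2 * (real s)\<^sup>2"
    using sum_squares_ge_zero[of "real s" "real s - 1"] by (simp add: power2_eq_square algebra_simps)
  finally have key: "(real (2 * s\<^sup>2) - real k) * real s \<le> 2 * (real s + 1) * (real (s\<^sup>2) - real k)"
    by (simp add: power2_eq_square algebra_simps)
  have "real (Suc k) * (real ((2 * s\<^sup>2) choose Suc k) * real s ^ Suc k)
    = ((real (2 * s\<^sup>2) - real k) * real s) * (real ((2 * s\<^sup>2) choose k) * real s ^ k)"
    using step[OF ks(2)] by (simp add: mult_ac)
  also have "\<dots> \<le> (2 * (real s + 1) * (real (s\<^sup>2) - real k)) * ((2 * (real s + 1)) ^ k * real (s\<^sup>2 choose k))"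
  proof (rule mult_mono[OF key Suc.IH])
    have "real k \<le> real (s\<^sup>2)" using ks(1) by (simp only: of_nat_le_iff)
    then show "0 \<le> 2 * (real s + 1) * (real (s\<^sup>2) - real k)" by (intro mult_nonneg_nonneg) auto
  qed (use Suc.prems in auto)
  also have "\<dots> = (2 * (real s + 1)) ^ Suc k * ((real (s\<^sup>2) - real k) * real (s\<^sup>2 choose k))"
    by (simp only: power_Suc mult_ac)
  also have "\<dots> = (2 * (real s + 1)) ^ Suc k * (real (Suc k) * real (s\<^sup>2 choose Suc k))"
    by (simp only: step[OF ks(1)])
  also have "\<dots> = real (Suc k) * ((2 * (real s + 1)) ^ Suc k * real (s\<^sup>2 choose Suc k))"
    by (rule mult.left_commute)
  finally show ?case by (rule mult_left_le_imp_le) simp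
qed simp

text \<open>The loss beyond \<open>2 ^ s\<close> is \<open>(1 + 1 / s) ^ s\<close>, which stays
  below 3; a small side of quadratic size keeps it bounded.\<close>

lemma binomial_double_square_le:
  assumes "s > 0"
  shows "(2 * s\<^sup>2) choose s \<le> 3 * 2 ^ s * (s\<^sup>2 choose s)"
proof -
  have "(1 + 1 / real s) ^ s \<le> exp 1"
    using exp_ge_one_plus_x_over_n_power_n[of s 1] assms by simp
  also have "\<dots> \<le> 3" by (rule exp_le)
  finally have e: "(1 + 1 / real s) ^ s \<le> 3" .
  have "real ((2 * s\<^sup>2) choose s) * real s ^ s \<le> (2 * (real s + 1)) ^ s * real (s\<^sup>2 choose s)"
    by (rule binomial_double_le) simp
  also have "2 * (real s + 1) = 2 * (1 + 1 / real s) * real s"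
    using assms by (simp add: field_simps)
  also have "(2 * (1 + 1 / real s) * real s) ^ s = 2 ^ s * (1 + 1 / real s) ^ s * real s ^ s"
    by (simp only: power_mult_distrib)
  also have "\<dots> * real (s\<^sup>2 choose s) = (2 ^ s * (1 + 1 / real s) ^ s * real (s\<^sup>2 choose s)) * real s ^ s"
    by simp
  finally have "real ((2 * s\<^sup>2) choose s) \<le> 2 ^ s * (1 + 1 / real s) ^ s * real (s\<^sup>2 choose s)"
    by (rule mult_right_le_imp_le) (use assms in simp)
  also have "\<dots> \<le> 2 ^ s * 3 * real (s\<^sup>2 choose s)"
    by (intro mult_right_mono mult_left_mono e) auto
  finally have "real ((2 * s\<^sup>2) choose s) \<le> real (3 * 2 ^ s * (s\<^sup>2 choose s))" by simp
  then show ?thesis by (simp only: of_nat_le_iff)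
qed

lemma size_ramsey_witness:
  assumes s: "s > 0" and t: "t > 0"
  defines "G \<equiv> \<lparr>verts = {..<2 * s\<^sup>2 + 6 * t * 2 ^ s},
      edges = bip {..<2 * s\<^sup>2} {2 * s\<^sup>2..<2 * s\<^sup>2 + 6 * t * 2 ^ s}\<rparr>"
  shows "finite_simple_graph G" and "ramsey_for G (complete_bipartite s t)"
    and "card (edges G) = 12 * s\<^sup>2 * t * 2 ^ s"
proof -
  define n where "n = s\<^sup>2"
  let ?A = "{..<2 * n}" and ?B = "{2 * n..<2 * n + 6 * t * 2 ^ s}"
  have G: "verts G = {..<2 * n + 6 * t * 2 ^ s}" "edges G = bip ?A ?B" by (simp_all add: G_def n_def)
  show "finite_simple_graph G"
    unfolding finite_simple_graph_def G bip_def by (auto simp: card_insert_if)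
  have "?A \<inter> ?B = {}" by auto
  then show "card (edges G) = 12 * s\<^sup>2 * t * 2 ^ s" unfolding G by (simp add: card_bip n_def)
  show "ramsey_for G (complete_bipartite s t)"
    unfolding ramsey_for_def
  proof
    fix col :: "nat set \<Rightarrow> bool"
    \<comment> \<open>A tie counts as \<open>True\<close>; in either case at least half of the
      \<open>2 * n\<close> edges at \<open>y\<close> have the color \<open>maj y\<close>.\<close>
    define maj where "maj y = (n \<le> card {x \<in> ?A. col {x, y}})" for y
    define M where "M y = {x \<in> ?A. col {x, y} = maj y}" for y
    have M: "n \<le> card (M y)" "M y \<subseteq> ?A" for y
    proof -
      have "card {x \<in> ?A. col {x, y}} + card {x \<in> ?A. \<not> col {x, y}}
          = card ({x \<in> ?A. col {x, y}} \<union> {x \<in> ?A. \<not> col {x, y}})"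
        by (rule card_Un_disjoint[symmetric]) auto
      also have "{x \<in> ?A. col {x, y}} \<union> {x \<in> ?A. \<not> col {x, y}} = ?A" by auto
      finally have "card {x \<in> ?A. col {x, y}} + card {x \<in> ?A. \<not> col {x, y}} = 2 * n" by simp
      then show "n \<le> card (M y)" by (cases "maj y") (auto simp: M_def maj_def)
      show "M y \<subseteq> ?A" unfolding M_def by auto
    qed
    obtain b where b: "3 * t * 2 ^ s \<le> card {y \<in> ?B. maj y = b}"
    proof -
      have "card {y \<in> ?B. maj y} + card {y \<in> ?B. \<not> maj y} = card ({y \<in> ?B. maj y} \<union> {y \<in> ?B. \<not> maj y})"
        by (rule card_Un_disjoint[symmetric]) auto
      also have "{y \<in> ?B. maj y} \<union> {y \<in> ?B. \<not> maj y} = ?B" by auto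
      finally have "card {y \<in> ?B. maj y} + card {y \<in> ?B. \<not> maj y} = 6 * t * 2 ^ s" by simp
      then consider "3 * t * 2 ^ s \<le> card {y \<in> ?B. maj y}" | "3 * t * 2 ^ s \<le> card {y \<in> ?B. \<not> maj y}"
        by linarith
      then show ?thesis using that[of True] that[of False] by cases simp_all
    qed
    define Y where "Y = {y \<in> ?B. maj y = b}"
    define SS where "SS = {S. S \<subseteq> ?A \<and> card S = s}"
    have fin: "finite SS" "finite Y" unfolding SS_def Y_def by auto
    have cSS: "card SS = (2 * n) choose s" unfolding SS_def using n_subsets[of ?A s] by simp
    \<comment> \<open>Double counting of the pairs of \<open>y\<close> and an
      \<open>s\<close>-subset of \<open>M y\<close>: if every \<open>S\<close> had fewer than
      \<open>t\<close> such \<open>y\<close>, the total would contradict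
      \<open>binomial_double_square_le\<close>.\<close>
    have "\<exists>S\<in>SS. t \<le> card {y \<in> Y. S \<subseteq> M y}"
    proof (rule ccontr)
      assume "\<not> ?thesis"
      then have lt: "card {y \<in> Y. S \<subseteq> M y} < t" if "S \<in> SS" for S using that by (simp add: not_le)
      have "n choose s \<le> card {S \<in> SS. S \<subseteq> M y}" for y
      proof -
        have "{S \<in> SS. S \<subseteq> M y} = {S. S \<subseteq> M y \<and> card S = s}" using M(2)[of y] unfolding SS_def by auto
        moreover have "finite (M y)" using M(2)[of y] by (rule finite_subset) simp
        ultimately have "card {S \<in> SS. S \<subseteq> M y} = card (M y) choose s" by (simp add: n_subsets)
        then show ?thesis using binomial_right_mono[OF M(1)[of y], of s] by simp
      qed
      then have "(\<Sum>y\<in>Y. n choose s) \<le> (\<Sum>y\<in>Y. card {S \<in> SS. S \<subseteq> M y})" by (rule sum_mono)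
      also have "\<dots> = (\<Sum>S\<in>SS. card {y \<in> Y. S \<subseteq> M y})"
        by (rule sum_multicount_gen) (auto simp: fin)
      also have "\<dots> < (\<Sum>S\<in>SS. t)"
      proof (rule sum_strict_mono[OF fin(1) _ lt])
        have "s \<le> 2 * n" using s by (simp add: n_def power2_eq_square)
        then have "card SS > 0" unfolding cSS by simp
        then show "SS \<noteq> {}" by auto
      qed
      finally have "card Y * (n choose s) < ((2 * n) choose s) * t" by (simp add: cSS)
      moreover have "3 * t * 2 ^ s * (n choose s) \<le> card Y * (n choose s)"
        using b unfolding Y_def by (rule mult_right_mono) simp
      moreover have "((2 * n) choose s) * t \<le> 3 * t * 2 ^ s * (n choose s)"
        using mult_right_mono[OF binomial_double_square_le[OF s], of t] by (simp add: n_def mult_ac)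
      ultimately show False by (meson leD order_trans)
    qed
    then obtain S where S: "S \<in> SS" "t \<le> card {y \<in> Y. S \<subseteq> M y}" by blast
    obtain T where T: "T \<subseteq> {y \<in> Y. S \<subseteq> M y}" "card T = t" "finite T"
      by (rule obtain_subset_with_card_n[OF S(2)])
    have ST: "S \<subseteq> ?A" "T \<subseteq> ?B" "card S = s" using S(1) T(1) unfolding SS_def Y_def by auto
    have "is_copy_in \<lparr>verts = S \<union> T, edges = bip S T\<rparr> (complete_bipartite s t) G"
    proof (rule copy_of_sides)
      show "finite S" using ST(1) by (rule finite_subset) simp
      show "S \<inter> T = {}" using ST \<open>?A \<inter> ?B = {}\<close> by blast
      show "bip S T \<subseteq> edges G" unfolding G bip_def using ST by blast
      show "S \<subseteq> verts G" "T \<subseteq> verts G" unfolding G using ST by auto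
    qed (use ST T in auto)
    moreover have "\<forall>e\<in>bip S T. col e = b"
    proof
      fix e assume "e \<in> bip S T"
      then obtain x y where "x \<in> S" "y \<in> T" "e = {x, y}" unfolding bip_def by auto
      moreover from this have "x \<in> M y" "maj y = b" using T(1) unfolding Y_def by auto
      ultimately show "col e = b" unfolding M_def by simp
    qed
    ultimately show "\<exists>K b. is_copy_in K (complete_bipartite s t) G \<and> (\<forall>e\<in>edges K. col e = b)"
      by (metis ugraph.select_convs(2))
  qed
qed

lemma size_ramsey_upper:
  assumes "s > 0" "t > 0"
  shows "size_ramsey (complete_bipartite s t) \<le> 12 * s\<^sup>2 * t * 2 ^ s"
  unfolding size_ramsey_def using size_ramsey_witness[OF assms] by (intro Least_le) blast

section \<open>Lower bounds\<close>

text \<open>The graph of \<open>size_ramsey_witness\<close> shows that the set minimized in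
  \<open>size_ramsey\<close> is nonempty.\<close>

lemma size_ramsey_attained:
  assumes "s > 0" "t > 0"
  obtains G :: "nat ugraph" where "finite_simple_graph G" "ramsey_for G (complete_bipartite s t)"
    "card (edges G) = size_ramsey (complete_bipartite s t)"
proof -
  let ?P = "\<lambda>m. \<exists>G :: nat ugraph. finite_simple_graph G \<and> ramsey_for G (complete_bipartite s t) \<and> card (edges G) = m"
  have "?P (12 * s\<^sup>2 * t * 2 ^ s)" using size_ramsey_witness[OF assms] by blast
  then have "?P (size_ramsey (complete_bipartite s t))" unfolding size_ramsey_def by (rule LeastI)
  then show ?thesis using that by blast
qed

text \<open>A Ramsey graph contains a copy under any coloring. This crude bound settles bounded
  \<open>s\<close>.\<close>

lemma size_ramsey_ge_edges:
  assumes "s > 0" "t > 0"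
  shows "s * t \<le> size_ramsey (complete_bipartite s t)"
proof -
  obtain G :: "nat ugraph" where G: "finite_simple_graph G" "ramsey_for G (complete_bipartite s t)"
    "card (edges G) = size_ramsey (complete_bipartite s t)"
    using size_ramsey_attained[OF assms] by blast
  obtain K where "is_copy_in K (complete_bipartite s t) G"
    using G(2) unfolding ramsey_for_def by blast
  then obtain S T where ST: "card S = s" "card T = t" "S \<inter> T = {}" "edges K = bip S T" "edges K \<subseteq> edges G"
    by (rule copy_sides) blast
  have "finite (edges G)"
    using G(1) unfolding finite_simple_graph_def by (intro finite_subset[of "edges G" "Pow (verts G)"]) auto
  then have "card (bip S T) \<le> card (edges G)" using ST by (intro card_mono) auto
  then show ?thesis using ST G(3) by (simp add: card_bip)
qed

text \<open>The constant is \<open>c\<close> of \<open>coloring_exists\<close> written out: a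
  minimal Ramsey graph with fewer edges would have a coloring without monochromatic copies.\<close>

lemma size_ramsey_lower:
  fixes A :: real
  assumes s: "s \<ge> 2" "2 * s \<le> t" and A: "A \<ge> 1" "real s ^ s \<le> A ^ t"
  shows "1 / (384 * A ^ 4) / (240 * A ^ 2) * real s ^ 2 * real t * 2 ^ s
    \<le> real (size_ramsey (complete_bipartite s t))"
proof (rule ccontr)
  assume less: "\<not> ?thesis"
  have "s > 0" "t > 0" using s by auto
  then obtain G :: "nat ugraph" where G: "finite_simple_graph G" "ramsey_for G (complete_bipartite s t)"
    "card (edges G) = size_ramsey (complete_bipartite s t)"
    using size_ramsey_attained by blast
  interpret fgraph "verts G" "edges G"
    using G(1) unfolding finite_simple_graph_def by unfold_locales auto
  obtain col where col: "\<forall>(S, T)\<in>sides s t. \<forall>b::bool. \<exists>e\<in>bip S T. col e \<noteq> b"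
    using coloring_exists[OF s A refl refl] less G(3) by auto
  obtain K b where K: "is_copy_in K (complete_bipartite s t) G" "\<forall>e\<in>edges K. col e = b"
    using G(2) unfolding ramsey_for_def by blast
  from K(1) obtain S T where "S \<subseteq> verts G" "T \<subseteq> verts G" "card S = s" "card T = t"
    "S \<inter> T = {}" "edges K = bip S T" "edges K \<subseteq> edges G"
    by (rule copy_sides) blast
  moreover from this have "(S, T) \<in> sides s t" unfolding sides_def by simp
  then have "\<exists>e\<in>bip S T. col e \<noteq> b" using col by blast
  ultimately show False using K(2) by auto
qed

theorem corollary1p2:
  shows "\<forall>a::real. a > 0 \<longrightarrow>
    (\<exists>c C :: real. c > 0 \<and> C > 0 \<and>
      (\<forall>s t :: nat. 1 \<le> s \<longrightarrow> s \<le> t \<longrightarrow> real t \<ge> a * real s * log 2 (real s) \<longrightarrow>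
         c * real s ^ 2 * real t * 2 ^ s \<le> real (size_ramsey (complete_bipartite s t)) \<and>
         real (size_ramsey (complete_bipartite s t)) \<le> C * real s ^ 2 * real t * 2 ^ s))"
proof (intro allI impI)
  fix a :: real assume a: "a > 0"
  \<comment> \<open>From \<open>s * log 2 s \<le> t / a\<close> it follows that \<open>s ^ s\<close>
    is at most \<open>2 powr (t / a)\<close>, which is \<open>A ^ t\<close>.\<close>
  define A where "A = 2 powr (1 / a)"
  have A1: "A \<ge> 1" unfolding A_def using a by (simp add: ge_one_powr_ge_zero)
  \<comment> \<open>From \<open>N\<close> on, \<open>a * log 2 s\<close> is at least 2, hence
    \<open>2 * s \<le> t\<close>; the summand 2 also gives \<open>s \<ge> 2\<close>.\<close>
  define N where "N = nat \<lceil>2 powr (2 / a)\<rceil> + 2"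
  \<comment> \<open>For \<open>s < N\<close> this makes \<open>c1 * s * 2 ^ s \<le> 1\<close>, so
    the bound \<open>s * t\<close> is enough.\<close>
  define c1 where "c1 = 1 / (real N * 2 ^ N)"
  define c2 where "c2 = 1 / (384 * A ^ 4) / (240 * A ^ 2)"
  have "N > 0" by (simp add: N_def)
  then have pos: "c1 > 0" "c2 > 0" unfolding c1_def c2_def using A1 by auto
  show "\<exists>c C :: real. c > 0 \<and> C > 0 \<and>
      (\<forall>s t :: nat. 1 \<le> s \<longrightarrow> s \<le> t \<longrightarrow> real t \<ge> a * real s * log 2 (real s) \<longrightarrow>
         c * real s ^ 2 * real t * 2 ^ s \<le> real (size_ramsey (complete_bipartite s t)) \<and>
         real (size_ramsey (complete_bipartite s t)) \<le> C * real s ^ 2 * real t * 2 ^ s)"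
  proof (rule exI[of _ "min c1 c2"], rule exI[of _ 12], intro conjI allI impI)
    show "min c1 c2 > 0" using pos by simp
    fix s t :: nat assume s: "1 \<le> s" and st: "s \<le> t" and t: "real t \<ge> a * real s * log 2 (real s)"
    have "real (size_ramsey (complete_bipartite s t)) \<le> real (12 * s\<^sup>2 * t * 2 ^ s)"
      using s st by (intro of_nat_mono size_ramsey_upper) auto
    then show "real (size_ramsey (complete_bipartite s t)) \<le> 12 * real s ^ 2 * real t * 2 ^ s" by simp
    have mono: "min c1 c2 * real s ^ 2 * real t * 2 ^ s \<le> c * real s ^ 2 * real t * 2 ^ s"
      if "min c1 c2 \<le> c" for c
      using that by (intro mult_right_mono) auto
    show "min c1 c2 * real s ^ 2 * real t * 2 ^ s \<le> real (size_ramsey (complete_bipartite s t))"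
    proof (cases "s < N")
      case True
      have "real s * 2 ^ s \<le> real N * 2 ^ N"
        using True by (intro mult_mono power_increasing) auto
      then have le1: "c1 * (real s * 2 ^ s) \<le> 1" using \<open>N > 0\<close> unfolding c1_def by (simp add: field_simps)
      have "min c1 c2 * real s ^ 2 * real t * 2 ^ s \<le> c1 * real s ^ 2 * real t * 2 ^ s" by (rule mono) simp
      also have "\<dots> = (c1 * (real s * 2 ^ s)) * (real s * real t)" by (simp add: power2_eq_square)
      also have "\<dots> \<le> 1 * (real s * real t)" using le1 by (rule mult_right_mono) simp
      also have "\<dots> \<le> real (size_ramsey (complete_bipartite s t))"
        using size_ramsey_ge_edges[of s t] s st by (simp flip: of_nat_mult)
      finally show ?thesis .
    next
      case False
      have sp: "real s > 0" using s by simp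
      have "2 powr (2 / a) \<le> real (nat \<lceil>2 powr (2 / a)\<rceil>)" by (rule real_nat_ceiling_ge)
      also have "\<dots> \<le> real N" unfolding N_def of_nat_add by simp
      also have "\<dots> \<le> real s" using False by simp
      finally have "2 / a \<le> log 2 (real s)" using sp by (simp add: le_log_iff)
      then have "2 \<le> a * log 2 (real s)" using a by (simp add: field_simps)
      then have "real s * 2 \<le> real s * (a * log 2 (real s))" by (rule mult_left_mono) simp
      also have "\<dots> \<le> real t" using t by (simp add: mult_ac)
      finally have t2: "2 * s \<le> t" by linarith
      have "real s ^ s = (2 powr log 2 (real s)) powr real s" using sp by (simp add: powr_realpow)
      also have "\<dots> = 2 powr (real s * log 2 (real s))" by (simp add: powr_powr mult.commute)
      also have "\<dots> \<le> 2 powr (real t / a)"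
        using t a by (intro powr_mono) (auto simp: field_simps)
      also have "\<dots> = A ^ t" unfolding A_def by (simp add: powr_realpow[symmetric] powr_powr)
      finally have sA: "real s ^ s \<le> A ^ t" .
      have "min c1 c2 * real s ^ 2 * real t * 2 ^ s \<le> c2 * real s ^ 2 * real t * 2 ^ s" by (rule mono) simp
      also have "\<dots> \<le> real (size_ramsey (complete_bipartite s t))"
        unfolding c2_def using False by (intro size_ramsey_lower t2 A1 sA) (simp add: N_def)
      finally show ?thesis .
    qed
  qed simp
qed

end
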